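(* Let $\mathcal{A}$ be a decision problem on pairs of inputs $a,b$ of length $n$ that can be decided in $\mathsf{NSPACE}[\mathrm{polylog}(n)]$. Then $\mathcal{A}$-Satisfying-Pair, on two sets of $N$ strings of length $2^{(\log N)^{o(1)}}$, can be reduced in near-linear time ($N^{1+o(1)}$) to BP-Satisfying-Pair on a branching program of size $2^{(\log N)^{o(1)}}$.
   Context: $\mathcal{A}$-Satisfying-Pair: given two sets $A,B$ of $N$ strings, decide whether there is $(a,b)\in A\times B$ such that $(a,b)$ is a yes-instance of $\mathcal{A}$. A (nondeterministic) branching program (BP) of length $T$ and width $W$ on Boolean inputs $x_1,\dots,x_n$ is a layered directed graph with $T$ layers of $W$ nodes; all nodes of layer $i<T$ are labelled by one variable $x_{f(i)}$; edges go between consecutive layers and are marked $0$ or $1$; its size is the number of edges ($O(W^2T)$); it accepts $x$ iff there is a path from the first node of layer $1$ to the first node of layer $T$ using only edges whose mark equals the value of the variable labelling their starting node. BP-Satisfying-Pair: given a BP $P$ on $n$ inputs and two sets $A,B\subseteq\{0,1\}^{n/2}$ of $N$ strings, decide whether $P$ accepts the concatenation of some $a\in A$ and $b\in B$. *)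

theory Defs
  imports Complex_Main "HOL-Library.Log_Nat"
begin

section \<open>Nondeterministic space\<close>

text \<open>
  Off-line nondeterministic Turing machines: a two-way read-only input tape holding a binary
  string between end markers, and one semi-infinite read/write work tape. States and work symbols
  are natural numbers, the blank work symbol is 0. A transition
  \<open>(q, s, g, q', g', d, d')\<close> applies in state \<open>q\<close> when \<open>s\<close> is scanned on the input tape and
  \<open>g\<close> on the work tape; it enters \<open>q'\<close>, overwrites \<open>g\<close> by \<open>g'\<close> and moves the input head by \<open>d\<close>
  and the work head by \<open>d'\<close>. As the transition relation is finite, only finitely many states
  and symbols occur.
\<close>

datatype insym = LeftEnd | Bit bool | RightEnd

datatype dir = MoveL | Stay | MoveR

record ntm =
  ntm_start :: nat
  ntm_accept :: nat
  ntm_delta :: "(nat \<times> insym \<times> nat \<times> nat \<times> nat \<times> dir \<times> dir) set"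

definition wf_ntm :: "ntm \<Rightarrow> bool" where
  "wf_ntm M \<longleftrightarrow> finite (ntm_delta M)"

text \<open>Configurations: state, input head position, work head position, work tape contents.\<close>

type_synonym ntm_conf = "nat \<times> nat \<times> nat \<times> (nat \<Rightarrow> nat)"

definition input_at :: "bool list \<Rightarrow> nat \<Rightarrow> insym" where
  "input_at x i =
     (if i = 0 then LeftEnd else if i \<le> length x then Bit (x ! (i - 1)) else RightEnd)"

fun move :: "dir \<Rightarrow> nat \<Rightarrow> nat" where
  "move MoveL i = i - 1"
| "move Stay i = i"
| "move MoveR i = i + 1"

definition ntm_init :: "ntm \<Rightarrow> ntm_conf" where
  "ntm_init M = (ntm_start M, 0, 0, \<lambda>_. 0)"

text \<open>The input head is confined to the input and its two end markers.\<close>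

inductive ntm_step :: "ntm \<Rightarrow> bool list \<Rightarrow> ntm_conf \<Rightarrow> ntm_conf \<Rightarrow> bool"
  for M :: ntm and x :: "bool list" where
  "(q, input_at x i, w h, q', g', d, d') \<in> ntm_delta M \<Longrightarrow>
   ntm_step M x (q, i, h, w) (q', min (move d i) (length x + 1), move d' h, w(h := g'))"

definition ntm_reachable :: "ntm \<Rightarrow> bool list \<Rightarrow> ntm_conf \<Rightarrow> bool" where
  "ntm_reachable M x c \<longleftrightarrow> (ntm_step M x)\<^sup>*\<^sup>* (ntm_init M) c"

definition ntm_accepts :: "ntm \<Rightarrow> bool list \<Rightarrow> bool" where
  "ntm_accepts M x \<longleftrightarrow> (\<exists>i h w. ntm_reachable M x (ntm_accept M, i, h, w))"

text \<open>
  Only work tape cells count as space. The work head starts on cell 0 and moves by single steps,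
  so a computation visits at most \<open>S\<close> cells iff all its work head positions \<open>h\<close>
  satisfy \<open>h + 1 \<le> S\<close>. The bound is imposed on all computations.
\<close>

definition NSPACE :: "(nat \<Rightarrow> real) \<Rightarrow> bool list set set" where
  "NSPACE s = {L. \<exists>M. wf_ntm M \<and> (\<forall>x. x \<in> L \<longleftrightarrow> ntm_accepts M x) \<and>
     (\<forall>x q i h w. ntm_reachable M x (q, i, h, w) \<longrightarrow> real (h + 1) \<le> s (length x))}"

definition NSPACE_polylog :: "bool list set set" where
  "NSPACE_polylog = (\<Union>(k::nat) (c::nat). NSPACE (\<lambda>n. real c * (log 2 (real n)) ^ k + real c))"

text \<open>
  The two inputs have equal length, so the concatenation determines the pair.
\<close>

definition pair_language :: "(bool list \<Rightarrow> bool list \<Rightarrow> bool) \<Rightarrow> bool list set" where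
  "pair_language R = {a @ b | a b. length a = length b \<and> R a b}"

section \<open>Branching programs\<close>

text \<open>
  Layers, nodes in a layer, and variables are numbered from 0. An edge \<open>(i, u, v, m)\<close> leads from
  node \<open>u\<close> of layer \<open>i\<close> to node \<open>v\<close> of layer \<open>i + 1\<close> and carries the mark \<open>m\<close>.
\<close>

record bp =
  bp_inputs :: nat
  bp_length :: nat
  bp_width :: nat
  bp_label :: "nat \<Rightarrow> nat"
  bp_edges :: "(nat \<times> nat \<times> nat \<times> bool) set"

definition wf_bp :: "bp \<Rightarrow> bool" where
  "wf_bp P \<longleftrightarrow> 1 \<le> bp_length P \<and> 1 \<le> bp_width P \<and>
     (\<forall>i. i + 1 < bp_length P \<longrightarrow> bp_label P i < bp_inputs P) \<and>
     (\<forall>(i, u, v, m) \<in> bp_edges P. i + 1 < bp_length P \<and> u < bp_width P \<and> v < bp_width P)"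

definition bp_size :: "bp \<Rightarrow> nat" where
  "bp_size P = card (bp_edges P)"

definition bp_accepts :: "bp \<Rightarrow> bool list \<Rightarrow> bool" where
  "bp_accepts P x \<longleftrightarrow> (\<exists>p :: nat \<Rightarrow> nat. p 0 = 0 \<and> p (bp_length P - 1) = 0 \<and>
     (\<forall>i. i + 1 < bp_length P \<longrightarrow> (i, p i, p (i + 1), x ! bp_label P i) \<in> bp_edges P))"

section \<open>Satisfying-Pair problems and their encodings\<close>

definition satisfying_pair ::
    "(bool list \<Rightarrow> bool list \<Rightarrow> bool) \<Rightarrow> bool list set \<Rightarrow> bool list set \<Rightarrow> bool" where
  "satisfying_pair R A B \<longleftrightarrow> (\<exists>a\<in>A. \<exists>b\<in>B. R a b)"

definition bp_satisfying_pair :: "bp \<Rightarrow> bool list set \<Rightarrow> bool list set \<Rightarrow> bool" where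
  "bp_satisfying_pair P A B \<longleftrightarrow> satisfying_pair (\<lambda>a b. bp_accepts P (a @ b)) A B"

definition string_set :: "nat \<Rightarrow> nat \<Rightarrow> bool list set \<Rightarrow> bool" where
  "string_set N n A \<longleftrightarrow> finite A \<and> card A = N \<and> (\<forall>a\<in>A. length a = n)"

definition bits :: "bool list list \<Rightarrow> nat list" where
  "bits as = map of_bool (concat as)"

text \<open>
  A set of strings is presented by listing its elements, without repetition, in any order.
\<close>

definition encodes_sets ::
    "nat \<Rightarrow> nat \<Rightarrow> bool list set \<Rightarrow> bool list set \<Rightarrow> nat list \<Rightarrow> bool" where
  "encodes_sets N n A B xs \<longleftrightarrow> string_set N n A \<and> string_set N n B \<and>
     (\<exists>as bs. distinct as \<and> set as = A \<and> distinct bs \<and> set bs = B \<and>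
        xs = [N, n] @ bits as @ bits bs)"

text \<open>
  A branching program is presented by its parameters, the labels of its layers, and the adjacency
  matrices between consecutive layers (one for each mark).
\<close>

definition bp_code :: "bp \<Rightarrow> nat list" where
  "bp_code P =
     [bp_inputs P, bp_length P, bp_width P] @
     map (bp_label P) [0..<bp_length P - 1] @
     [of_bool ((i, u, v, m) \<in> bp_edges P).
        i \<leftarrow> [0..<bp_length P - 1], u \<leftarrow> [0..<bp_width P], v \<leftarrow> [0..<bp_width P],
        m \<leftarrow> [False, True]]"

definition encodes_bp_sets ::
    "nat \<Rightarrow> bp \<Rightarrow> bool list set \<Rightarrow> bool list set \<Rightarrow> nat list \<Rightarrow> bool" where
  "encodes_bp_sets N P A B ys \<longleftrightarrow> wf_bp P \<and>
     (\<exists>m zs. bp_inputs P = 2 * m \<and> encodes_sets N m A B zs \<and> ys = bp_code P @ zs)"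

section \<open>Random access machines with logarithmic cost\<close>

text \<open>
  The random access machine of Aho, Hopcroft and Ullman, over the natural numbers and with
  three-address instructions. Register operands are memory addresses; \<open>Load i j\<close> is
  \<open>r\<^sub>i := mem[r\<^sub>j]\<close> and \<open>Store i j\<close> is \<open>mem[r\<^sub>i] := r\<^sub>j\<close>, with registers and memory being the same
  store. \<open>Sub\<close> is truncated, division by 0 gives 0, reading past the end of the input gives 0.
  The machine halts when the program counter leaves the program.
\<close>

datatype instr =
    Const nat nat
  | Add nat nat nat
  | Sub nat nat nat
  | Mul nat nat nat
  | Div nat nat nat
  | Load nat nat
  | Store nat nat
  | Read nat
  | Write nat
  | Jump nat
  | JZero nat nat

text \<open>Configurations: program counter, memory, remaining input, output so far.\<close>

type_synonym ram_conf = "nat \<times> (nat \<Rightarrow> nat) \<times> nat list \<times> nat list"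

fun ram_instr :: "instr \<Rightarrow> ram_conf \<Rightarrow> ram_conf" where
  "ram_instr (Const i c) (pc, r, inp, out) = (pc + 1, r(i := c), inp, out)"
| "ram_instr (Add i j k) (pc, r, inp, out) = (pc + 1, r(i := r j + r k), inp, out)"
| "ram_instr (Sub i j k) (pc, r, inp, out) = (pc + 1, r(i := r j - r k), inp, out)"
| "ram_instr (Mul i j k) (pc, r, inp, out) = (pc + 1, r(i := r j * r k), inp, out)"
| "ram_instr (Div i j k) (pc, r, inp, out) = (pc + 1, r(i := r j div r k), inp, out)"
| "ram_instr (Load i j) (pc, r, inp, out) = (pc + 1, r(i := r (r j)), inp, out)"
| "ram_instr (Store i j) (pc, r, inp, out) = (pc + 1, r(r i := r j), inp, out)"
| "ram_instr (Read i) (pc, r, inp, out) =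
     (pc + 1, r(i := (case inp of [] \<Rightarrow> 0 | v # _ \<Rightarrow> v)), tl inp, out)"
| "ram_instr (Write j) (pc, r, inp, out) = (pc + 1, r, inp, out @ [r j])"
| "ram_instr (Jump l) (pc, r, inp, out) = (l, r, inp, out)"
| "ram_instr (JZero j l) (pc, r, inp, out) = (if r j = 0 then l else pc + 1, r, inp, out)"

text \<open>
  Logarithmic cost: an instruction is charged the bit lengths of all operands and addresses it
  involves, where 0 has length 1.
\<close>

definition len :: "nat \<Rightarrow> nat" where
  "len v = max 1 (floorlog 2 v)"

fun instr_cost :: "instr \<Rightarrow> ram_conf \<Rightarrow> nat" where
  "instr_cost (Const i c) (pc, r, inp, out) = len i + len c"
| "instr_cost (Add i j k) (pc, r, inp, out) = len i + len j + len k + len (r j) + len (r k)"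
| "instr_cost (Sub i j k) (pc, r, inp, out) = len i + len j + len k + len (r j) + len (r k)"
| "instr_cost (Mul i j k) (pc, r, inp, out) = len i + len j + len k + len (r j) + len (r k)"
| "instr_cost (Div i j k) (pc, r, inp, out) = len i + len j + len k + len (r j) + len (r k)"
| "instr_cost (Load i j) (pc, r, inp, out) = len i + len j + len (r j) + len (r (r j))"
| "instr_cost (Store i j) (pc, r, inp, out) = len i + len j + len (r i) + len (r j)"
| "instr_cost (Read i) (pc, r, inp, out) =
     len i + len (case inp of [] \<Rightarrow> 0 | v # _ \<Rightarrow> v)"
| "instr_cost (Write j) (pc, r, inp, out) = len j + len (r j)"
| "instr_cost (Jump l) (pc, r, inp, out) = 1"
| "instr_cost (JZero j l) (pc, r, inp, out) = len j + len (r j)"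

inductive ram_exec :: "instr list \<Rightarrow> ram_conf \<Rightarrow> nat \<Rightarrow> ram_conf \<Rightarrow> bool"
  for p :: "instr list" where
  refl: "ram_exec p c 0 c"
| step: "fst c < length p \<Longrightarrow> ram_exec p (ram_instr (p ! fst c) c) t c' \<Longrightarrow>
         ram_exec p c (instr_cost (p ! fst c) c + t) c'"

text \<open>On input \<open>xs\<close> the program \<open>p\<close> halts with output \<open>ys\<close> after total cost \<open>t\<close>.\<close>

definition ram_computes :: "instr list \<Rightarrow> nat list \<Rightarrow> nat list \<Rightarrow> nat \<Rightarrow> bool" where
  "ram_computes p xs ys t \<longleftrightarrow>
     (\<exists>pc r inp. ram_exec p (0, \<lambda>_. 0, xs, []) t (pc, r, inp, ys) \<and> length p \<le> pc)"

section \<open>Growth rates\<close>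

text \<open>\<open>f(N) = 2\<^bsup>(log N)\<^bsup>o(1)\<^esup>\<^esup>\<close> and \<open>f(N) = N\<^bsup>1+o(1)\<^esup>\<close>, as asymptotic upper bounds.\<close>

definition exp_log_o1 :: "(nat \<Rightarrow> real) \<Rightarrow> bool" where
  "exp_log_o1 f \<longleftrightarrow> (\<exists>\<epsilon> :: nat \<Rightarrow> real. \<epsilon> \<longlonglongrightarrow> 0 \<and>
     (\<forall>\<^sub>F N in sequentially. f N \<le> 2 powr (log 2 (real N) powr \<epsilon> N)))"

definition near_linear :: "(nat \<Rightarrow> real) \<Rightarrow> bool" where
  "near_linear f \<longleftrightarrow> (\<exists>\<epsilon> :: nat \<Rightarrow> real. \<epsilon> \<longlonglongrightarrow> 0 \<and>
     (\<forall>\<^sub>F N in sequentially. f N \<le> real N powr (1 + \<epsilon> N)))"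

end

theory Submission
  imports Defs "HOL-Real_Asymp.Real_Asymp"
begin

text \<open>
  On inputs \<open>a @ b\<close> of length \<open>2 * n\<close> the machine uses \<open>S = polylog n\<close> cells, so it has at most
  \<open>W = 2\<^bsup>polylog n\<^esup>\<close> configurations and an accepting run of at most \<open>W\<^sup>2\<close> steps. The branching
  program has the configurations as nodes and sweeps over all variables again and again: in a layer
  that reads variable \<open>j\<close>, configurations with input head on cell \<open>j\<close> may make a step, and all
  configurations may stall. Padding the strings to \<open>False # a\<close> and \<open>b @ [False]\<close> gives the two end
  markers variables of their own, so that variable \<open>j\<close> is cell \<open>j\<close> of the input tape, and takes
  care of \<open>n = 0\<close>.

  A configuration is coded by one number with four digits in a large base (state, input head,
  \<open>B\<close> to the power of the work head position, tape contents in base \<open>B\<close>). The edge relation is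
  then an arithmetic expression in the numbers of the two nodes, and the random access machine
  prints the adjacency matrices with a constant number of registers, before it copies the strings.
  With \<open>n = 2\<^bsup>(log N)\<^bsup>o(1)\<^esup>\<^esup>\<close> everything polynomial in \<open>W\<close> is \<open>2\<^bsup>(log N)\<^bsup>o(1)\<^esup>\<^esup>\<close>.
\<close>

section \<open>An imperative language with bounded iteration\<close>

datatype aop = Plus | Minus | Times | Divide

fun apply_op :: "aop \<Rightarrow> nat \<Rightarrow> nat \<Rightarrow> nat" where
  "apply_op Plus a b = a + b"
| "apply_op Minus a b = a - b"
| "apply_op Times a b = a * b"
| "apply_op Divide a b = a div b"

datatype aexp = Num nat | Var nat | Bin aop aexp aexp

fun eval :: "aexp \<Rightarrow> (nat \<Rightarrow> nat) \<Rightarrow> nat" where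
  "eval (Num c) \<sigma> = c"
| "eval (Var x) \<sigma> = \<sigma> x"
| "eval (Bin f a b) \<sigma> = apply_op f (eval a \<sigma>) (eval b \<sigma>)"

datatype cmd =
    Assign nat aexp
  | Input nat
  | Output aexp
  | Seq cmd cmd (infixr \<open>;;\<close> 60)
  | Repeat aexp cmd

text \<open>States: values of the variables, remaining input, output so far.\<close>

type_synonym state = "(nat \<Rightarrow> nat) \<times> nat list \<times> nat list"

definition next_input :: "nat list \<Rightarrow> nat" where
  "next_input inp = (case inp of [] \<Rightarrow> 0 | v # _ \<Rightarrow> v)"

lemma next_input_Cons [simp]: "next_input (v # inp) = v"
  by (simp add: next_input_def)

primrec exec :: "cmd \<Rightarrow> state \<Rightarrow> state" where
  "exec (Assign x e) = (\<lambda>(\<sigma>, inp, out). (\<sigma>(x := eval e \<sigma>), inp, out))"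
| "exec (Input x) = (\<lambda>(\<sigma>, inp, out). (\<sigma>(x := next_input inp), tl inp, out))"
| "exec (Output e) = (\<lambda>(\<sigma>, inp, out). (\<sigma>, inp, out @ [eval e \<sigma>]))"
| "exec (c1 ;; c2) = (\<lambda>s. exec c2 (exec c1 s))"
| "exec (Repeat e c) = (\<lambda>s. (exec c ^^ eval e (fst s)) s)"

primrec steps :: "cmd \<Rightarrow> state \<Rightarrow> nat" where
  "steps (Assign x e) = (\<lambda>s. 1)"
| "steps (Input x) = (\<lambda>s. 1)"
| "steps (Output e) = (\<lambda>s. 1)"
| "steps (c1 ;; c2) = (\<lambda>s. steps c1 s + steps c2 (exec c1 s))"
| "steps (Repeat e c) = (\<lambda>s. 1 + (\<Sum>j<eval e (fst s). steps c ((exec c ^^ j) s) + 1))"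

primrec stores_at_most :: "nat \<Rightarrow> cmd \<Rightarrow> state \<Rightarrow> bool" where
  "stores_at_most X (Assign x e) = (\<lambda>s. eval e (fst s) \<le> X)"
| "stores_at_most X (Input x) = (\<lambda>s. next_input (fst (snd s)) \<le> X)"
| "stores_at_most X (Output e) = (\<lambda>s. True)"
| "stores_at_most X (c1 ;; c2) = (\<lambda>s. stores_at_most X c1 s \<and> stores_at_most X c2 (exec c1 s))"
| "stores_at_most X (Repeat e c) =
     (\<lambda>s. \<forall>j<eval e (fst s). stores_at_most X c ((exec c ^^ j) s))"

section \<open>Compilation to random access machines\<close>

fun op_instr :: "aop \<Rightarrow> nat \<Rightarrow> nat \<Rightarrow> nat \<Rightarrow> instr" where
  "op_instr Plus = Add"
| "op_instr Minus = Sub"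
| "op_instr Times = Mul"
| "op_instr Divide = Div"

text \<open>
  Variable \<open>x\<close> lives in register \<open>x\<close>; registers from \<open>d\<close> on are scratch.
\<close>

fun compile_exp :: "aexp \<Rightarrow> nat \<Rightarrow> instr list" where
  "compile_exp (Num c) d = [Const d c]"
| "compile_exp (Var x) d = [Const d 0, Add d d x]"
| "compile_exp (Bin f a b) d =
     compile_exp a d @ compile_exp b (d + 1) @ [op_instr f d d (d + 1)]"

text \<open>The number of iterations that are still to be made is kept in register \<open>d\<close>.\<close>

fun compile :: "cmd \<Rightarrow> nat \<Rightarrow> nat \<Rightarrow> instr list" where
  "compile (Assign x e) pc d = compile_exp e d @ [Const (d + 1) 0, Add x d (d + 1)]"
| "compile (Input x) pc d = [Read x]"
| "compile (Output e) pc d = compile_exp e d @ [Write d]"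
| "compile (c1 ;; c2) pc d =
     (let p1 = compile c1 pc d in p1 @ compile c2 (pc + length p1) d)"
| "compile (Repeat e c) pc d =
     (let h = compile_exp e d; l = pc + length h; b = compile c (l + 1) (d + 1)
      in h @ JZero d (l + length b + 4) # b @ [Const (d + 1) 1, Sub d d (d + 1), Jump l])"

text \<open>
  Constants and variable numbers count towards the size, so that the size of a program bounds
  all constants, all variables and the number of scratch registers of its compilation.
\<close>

fun esize :: "aexp \<Rightarrow> nat" where
  "esize (Num c) = c + 1"
| "esize (Var x) = x + 1"
| "esize (Bin f a b) = esize a + esize b + 1"

fun csize :: "cmd \<Rightarrow> nat" where
  "csize (Assign x e) = x + esize e + 2"
| "csize (Input x) = x + 1"
| "csize (Output e) = esize e + 1"
| "csize (c1 ;; c2) = csize c1 + csize c2"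
| "csize (Repeat e c) = esize e + csize c + 2"

lemma length_compile_exp_le: "length (compile_exp e d) \<le> 2 * esize e"
proof (induction e arbitrary: d)
  case (Bin f a b)
  show ?case using Bin(1)[of d] Bin(2)[of "d + 1"] by simp
qed auto

lemma csize_pos: "0 < csize c"
  by (induction c) auto

lemma apply_op_le_power:
  assumes "2 \<le> X" "a \<le> X ^ m" "b \<le> X ^ n"
  shows "apply_op f a b \<le> X ^ (m + n + 1)"
proof -
  have "X ^ m \<le> X ^ (m + n)" "X ^ n \<le> X ^ (m + n)"
    using assms(1) by (auto intro: power_increasing)
  then have "a \<le> X ^ (m + n)" "b \<le> X ^ (m + n)" using assms by linarith+
  moreover have "a * b \<le> X ^ (m + n)"
    unfolding power_add using assms by (intro mult_mono) auto
  moreover have "a div b \<le> a" by simp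
  ultimately have "apply_op f a b \<le> 2 * X ^ (m + n)" by (cases f; simp; linarith)
  also have "\<dots> \<le> X ^ (m + n + 1)" using assms(1) by simp
  finally show ?thesis .
qed

lemma eval_le_power:
  assumes "\<And>y. y < Z \<Longrightarrow> \<sigma> y \<le> X" "esize e \<le> Z" "2 \<le> X" "Z \<le> X"
  shows "eval e \<sigma> \<le> X ^ esize e"
  using assms(2)
proof (induction e)
  case (Num c)
  then have "c \<le> X" using assms by simp
  also have "X \<le> X ^ (c + 1)" using assms by (intro self_le_power) auto
  finally show ?case by simp
next
  case (Var x)
  then have "\<sigma> x \<le> X" using assms by simp
  also have "X \<le> X ^ (x + 1)" using assms by (intro self_le_power) auto
  finally show ?case by simp
next
  case (Bin f a b)
  then show ?case
    using apply_op_le_power[OF \<open>2 \<le> X\<close>, of "eval a \<sigma>" "esize a" "eval b \<sigma>" "esize b" f] by simp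
qed

definition code_at :: "instr list \<Rightarrow> nat \<Rightarrow> instr list \<Rightarrow> bool" where
  "code_at p pc cs \<longleftrightarrow> (\<forall>j<length cs. pc + j < length p \<and> p ! (pc + j) = cs ! j)"

lemma code_at_Nil [simp]: "code_at p pc []"
  by (simp add: code_at_def)

lemma code_at_Cons [simp]:
  "code_at p pc (i # cs) \<longleftrightarrow> pc < length p \<and> p ! pc = i \<and> code_at p (Suc pc) cs"
  by (simp add: code_at_def All_less_Suc2)

lemma code_at_append [simp]:
  "code_at p pc (cs @ ds) \<longleftrightarrow> code_at p pc cs \<and> code_at p (pc + length cs) ds"
  by (induction cs arbitrary: pc) auto

lemma len_mono: "a \<le> b \<Longrightarrow> len a \<le> len b"
  unfolding len_def using floorlog_mono[of a b 2] by auto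

fun operands :: "instr \<Rightarrow> (nat \<Rightarrow> nat) \<Rightarrow> nat list \<Rightarrow> nat list" where
  "operands (Const i c) r inp = [i, c]"
| "operands (Add i j k) r inp = [i, j, k, r j, r k]"
| "operands (Sub i j k) r inp = [i, j, k, r j, r k]"
| "operands (Mul i j k) r inp = [i, j, k, r j, r k]"
| "operands (Div i j k) r inp = [i, j, k, r j, r k]"
| "operands (Load i j) r inp = [i, j, r j, r (r j)]"
| "operands (Store i j) r inp = [i, j, r i, r j]"
| "operands (Read i) r inp = [i, next_input inp]"
| "operands (Write j) r inp = [j, r j]"
| "operands (Jump l) r inp = []"
| "operands (JZero j l) r inp = [j, r j]"

lemma instr_cost_le:
  assumes "\<forall>v\<in>set (operands ins r inp). v \<le> V"
  shows "instr_cost ins (pc, r, inp, out) \<le> 5 * len V"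
proof -
  have "\<forall>v\<in>set (operands ins r inp). len v \<le> len V"
    using assms len_mono by blast
  moreover have "1 \<le> len V" by (simp add: len_def)
  ultimately show ?thesis by (cases ins) (auto simp: next_input_def)
qed

lemma op_instr_simps [simp]:
  "operands (op_instr f i j k) r inp = [i, j, k, r j, r k]"
  "ram_instr (op_instr f i j k) (pc, r, inp, out) =
     (pc + 1, r(i := apply_op f (r j) (r k)), inp, out)"
  by (cases f; simp)+

lemma ram_exec_trans:
  "ram_exec p c t c' \<Longrightarrow> ram_exec p c' t' c'' \<Longrightarrow> ram_exec p c (t + t') c''"
proof (induction rule: ram_exec.induct)
  case (step c t c')
  then show ?case using ram_exec.step[of c p "t + t'" c''] by (simp add: add.assoc)
qed simp

text \<open>
  If \<open>Z\<close> bounds the size of a command and \<open>X\<close> all values of variables, then all intermediate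
  values of expressions are at most \<open>X ^ Z\<close>.
\<close>

locale ram_program =
  fixes p :: "instr list" and Z X :: nat
  assumes Z_pos: "0 < Z" and registers_le: "2 * Z + 2 \<le> X"
begin

definition runs :: "nat \<Rightarrow> ram_conf \<Rightarrow> ram_conf \<Rightarrow> bool" where
  "runs n c c' \<longleftrightarrow> (\<exists>t. ram_exec p c t c' \<and> t \<le> n * (5 * len (X ^ Z)))"

lemma runs_refl: "runs 0 c c"
  unfolding runs_def using ram_exec.refl by auto

lemma runs_trans [trans]: "runs m c c' \<Longrightarrow> runs n c' c'' \<Longrightarrow> runs (m + n) c c''"
  unfolding runs_def using ram_exec_trans[of p c _ c' _ c'']
  by (auto simp: add_mult_distrib intro: add_le_mono)

lemma runs_mono: "runs m c c' \<Longrightarrow> m \<le> n \<Longrightarrow> runs n c c'"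
  unfolding runs_def by (meson le_trans mult_le_mono1)

lemma runs_instr:
  assumes "pc < length p" "p ! pc = ins" "\<forall>v\<in>set (operands ins r inp). v \<le> X ^ Z"
    "ram_instr ins (pc, r, inp, out) = c'"
  shows "runs 1 (pc, r, inp, out) c'"
proof -
  have "ram_exec p (pc, r, inp, out) (instr_cost ins (pc, r, inp, out) + 0) c'"
    using ram_exec.step[OF _ ram_exec.refl, of "(pc, r, inp, out)" p] assms by simp
  then show ?thesis using instr_cost_le[OF assms(3)] unfolding runs_def by auto
qed

lemma le_power_Z: "v \<le> X \<Longrightarrow> v \<le> X ^ Z"
  using self_le_power[of X Z] Z_pos registers_le by simp

definition represents :: "(nat \<Rightarrow> nat) \<Rightarrow> (nat \<Rightarrow> nat) \<Rightarrow> bool" where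
  "represents r \<sigma> \<longleftrightarrow> (\<forall>y<Z. r y = \<sigma> y \<and> \<sigma> y \<le> X)"

lemma represents_upd: "represents r \<sigma> \<Longrightarrow> v \<le> X \<Longrightarrow> represents (r(x := v)) (\<sigma>(x := v))"
  by (simp add: represents_def)

lemma represents_cong:
  "represents r \<sigma> \<Longrightarrow> \<forall>y<Z. r' y = r y \<Longrightarrow> represents r' \<sigma>"
  by (simp add: represents_def)

lemma eval_le_power_Z:
  assumes "represents r \<sigma>" "esize e \<le> Z"
  shows "eval e \<sigma> \<le> X ^ Z"
proof -
  have "eval e \<sigma> \<le> X ^ esize e"
    using assms registers_le by (intro eval_le_power[of Z]) (auto simp: represents_def)
  also have "\<dots> \<le> X ^ Z" using assms registers_le by (intro power_increasing) auto
  finally show ?thesis .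
qed

lemma compile_exp_runs:
  assumes "represents r \<sigma>" "esize e \<le> Z" "Z \<le> d" "d + esize e \<le> 2 * Z"
    "code_at p pc (compile_exp e d)"
  shows "\<exists>r'. runs (length (compile_exp e d)) (pc, r, inp, out)
                (pc + length (compile_exp e d), r', inp, out) \<and>
              r' d = eval e \<sigma> \<and> (\<forall>y<d. r' y = r y)"
  using assms
proof (induction e arbitrary: pc r d)
  case (Num c)
  have "runs 1 (pc, r, inp, out) (pc + 1, r(d := c), inp, out)"
    using Num registers_le by (intro runs_instr) (auto intro!: le_power_Z)
  then show ?case by (intro exI[of _ "r(d := c)"]) (auto simp: fun_upd_def)
next
  case (Var x)
  then have var: "x < d" "r x = \<sigma> x" "\<sigma> x \<le> X" by (auto simp: represents_def)
  have "runs 1 (pc, r, inp, out) (pc + 1, r(d := 0), inp, out)"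
    using Var registers_le by (intro runs_instr) (auto intro!: le_power_Z)
  also have "runs 1 (pc + 1, r(d := 0), inp, out) (pc + 2, r(d := \<sigma> x), inp, out)"
    using Var var registers_le by (intro runs_instr[of _ "Add d d x"]) (auto intro!: le_power_Z)
  finally show ?case using var
    by (intro exI[of _ "r(d := \<sigma> x)"]) (auto simp: numeral_2_eq_2 fun_upd_def)
next
  case (Bin f a b)
  let ?la = "length (compile_exp a d)" and ?lb = "length (compile_exp b (d + 1))"
  obtain r1 where left: "runs ?la (pc, r, inp, out) (pc + ?la, r1, inp, out)"
      "r1 d = eval a \<sigma>" "\<forall>y<d. r1 y = r y"
    using Bin.IH(1)[of r d pc] Bin.prems by auto
  have "represents r1 \<sigma>" using represents_cong[OF Bin.prems(1)] left(3) Bin.prems(3) by simp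
  then obtain r2 where right: "runs ?lb (pc + ?la, r1, inp, out) (pc + ?la + ?lb, r2, inp, out)"
      "r2 (d + 1) = eval b \<sigma>" "\<forall>y<d + 1. r2 y = r1 y"
    using Bin.IH(2)[of r1 "d + 1" "pc + ?la"] Bin.prems by auto
  let ?r3 = "r2(d := eval (Bin f a b) \<sigma>)"
  note runs_trans[OF left(1) right(1)]
  also have "runs 1 (pc + ?la + ?lb, r2, inp, out) (pc + ?la + ?lb + 1, ?r3, inp, out)"
    using Bin.prems left right registers_le eval_le_power_Z[OF Bin.prems(1), of a]
      eval_le_power_Z[OF Bin.prems(1), of b]
    by (intro runs_instr[of _ "op_instr f d d (d + 1)"]) (auto intro!: le_power_Z simp: add.assoc)
  finally show ?case
    using left(3) right(3) by (intro exI[of _ ?r3]) (auto simp: add.assoc fun_upd_def)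
qed

definition loaded :: "cmd \<Rightarrow> nat \<Rightarrow> nat \<Rightarrow> bool" where
  "loaded c pc d \<longleftrightarrow>
     csize c \<le> Z \<and> Z \<le> d \<and> d + csize c \<le> 2 * Z \<and> code_at p pc (compile c pc d)"

text \<open>
  Evaluating an expression takes at most \<open>2 * Z\<close> instructions, and an iteration of a loop 4 more.
  The last conjunct saves the loop counters of the enclosing loops.
\<close>

definition simulates ::
    "cmd \<Rightarrow> state \<Rightarrow> nat \<Rightarrow> nat \<Rightarrow> (nat \<Rightarrow> nat) \<Rightarrow> (nat \<Rightarrow> nat) \<Rightarrow> bool" where
  "simulates c s pc d r r' \<longleftrightarrow>
     runs (steps c s * (2 * Z + 4)) (pc, r, snd s)
       (pc + length (compile c pc d), r', snd (exec c s)) \<and>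
     represents r' (fst (exec c s)) \<and> (\<forall>y. Z \<le> y \<and> y < d \<longrightarrow> r' y = r y)"

definition implemented :: "cmd \<Rightarrow> bool" where
  "implemented c \<longleftrightarrow> (\<forall>pc d r s. loaded c pc d \<longrightarrow> represents r (fst s) \<longrightarrow>
     stores_at_most X c s \<longrightarrow> (\<exists>r'. simulates c s pc d r r'))"

lemma implementedI:
  assumes "\<And>pc d r \<sigma> inp out. loaded c pc d \<Longrightarrow> represents r \<sigma> \<Longrightarrow>
    stores_at_most X c (\<sigma>, inp, out) \<Longrightarrow> \<exists>r'. simulates c (\<sigma>, inp, out) pc d r r'"
  shows "implemented c"
  unfolding implemented_def using assms by auto

lemma implementedE:
  assumes "implemented c" "loaded c pc d" "represents r (fst s)" "stores_at_most X c s"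
  obtains r' where "simulates c s pc d r r'"
  using assms unfolding implemented_def by blast

lemma loaded_exp_runs:
  assumes "represents r \<sigma>" "Z \<le> d" "d + esize e \<le> 2 * Z" "code_at p pc (compile_exp e d)"
  obtains r' where
    "runs (length (compile_exp e d)) (pc, r, inp, out)
      (pc + length (compile_exp e d), r', inp, out)"
    "r' d = eval e \<sigma>" "\<forall>y<d. r' y = r y" "represents r' \<sigma>"
proof -
  have "esize e \<le> Z" using assms(2,3) by simp
  then obtain r' where r': "runs (length (compile_exp e d)) (pc, r, inp, out)
      (pc + length (compile_exp e d), r', inp, out)" "r' d = eval e \<sigma>" "\<forall>y<d. r' y = r y"
    using compile_exp_runs[OF assms(1) _ assms(2-4)] by blast
  moreover have "represents r' \<sigma>" using r'(3) assms(2) by (intro represents_cong[OF assms(1)]) simp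
  ultimately show thesis by (rule that)
qed

lemma implemented_Assign: "implemented (Assign x e)"
proof (rule implementedI)
  fix pc d r and \<sigma> :: "nat \<Rightarrow> nat" and inp out
  assume loaded: "loaded (Assign x e) pc d" and repr: "represents r \<sigma>"
    and bound: "stores_at_most X (Assign x e) (\<sigma>, inp, out)"
  let ?l = "length (compile_exp e d)" and ?v = "eval e \<sigma>"
  have size: "x < Z" "Z \<le> d" "d + esize e + 2 \<le> 2 * Z"
    and code: "code_at p pc (compile_exp e d)"
      "code_at p (pc + ?l) [Const (d + 1) 0, Add x d (d + 1)]"
    using loaded by (auto simp: loaded_def)
  obtain r1 where eval: "runs ?l (pc, r, inp, out) (pc + ?l, r1, inp, out)"
      "r1 d = ?v" "\<forall>y<d. r1 y = r y" "represents r1 \<sigma>"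
    using loaded_exp_runs[OF repr _ _ code(1)] size by auto
  let ?r2 = "r1(d + 1 := 0)" and ?r3 = "r1(d + 1 := 0, x := ?v)"
  note eval(1)
  also have "runs 1 (pc + ?l, r1, inp, out) (pc + ?l + 1, ?r2, inp, out)"
    using code(2) size registers_le by (intro runs_instr) (auto intro!: le_power_Z)
  also have "runs 1 (pc + ?l + 1, ?r2, inp, out) (pc + ?l + 2, ?r3, inp, out)"
    using code(2) size registers_le eval(2) bound
    by (intro runs_instr[of _ "Add x d (d + 1)"]) (auto intro!: le_power_Z)
  finally have "runs (2 * Z + 4) (pc, r, inp, out) (pc + ?l + 2, ?r3, inp, out)"
    using runs_mono length_compile_exp_le[of e d] size by fastforce
  moreover have "represents ?r3 (\<sigma>(x := ?v))"
    using bound size by (intro represents_upd represents_cong[OF eval(4)]) auto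
  ultimately show "\<exists>r'. simulates (Assign x e) (\<sigma>, inp, out) pc d r r'"
    using eval(3) size by (intro exI[of _ ?r3]) (simp add: simulates_def add.assoc)
qed

lemma implemented_Input: "implemented (Input x)"
proof (rule implementedI)
  fix pc d r and \<sigma> :: "nat \<Rightarrow> nat" and inp out
  assume loaded: "loaded (Input x) pc d" and repr: "represents r \<sigma>"
    and bound: "stores_at_most X (Input x) (\<sigma>, inp, out)"
  let ?r' = "r(x := next_input inp)"
  have "runs 1 (pc, r, inp, out) (pc + 1, ?r', tl inp, out)"
    using loaded registers_le bound
    by (intro runs_instr[of _ "Read x"]) (auto intro!: le_power_Z simp: loaded_def next_input_def)
  then have "runs (2 * Z + 4) (pc, r, inp, out) (pc + 1, ?r', tl inp, out)"
    by (rule runs_mono) simp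
  then show "\<exists>r'. simulates (Input x) (\<sigma>, inp, out) pc d r r'"
    using loaded bound represents_upd[OF repr, of "next_input inp" x]
    by (intro exI[of _ ?r']) (simp add: simulates_def loaded_def)
qed

lemma implemented_Output: "implemented (Output e)"
proof (rule implementedI)
  fix pc d r and \<sigma> :: "nat \<Rightarrow> nat" and inp out
  assume loaded: "loaded (Output e) pc d" and repr: "represents r \<sigma>"
  let ?l = "length (compile_exp e d)" and ?v = "eval e \<sigma>"
  have size: "Z \<le> d" "d + esize e + 1 \<le> 2 * Z" "esize e \<le> Z"
    and code: "code_at p pc (compile_exp e d)" "code_at p (pc + ?l) [Write d]"
    using loaded by (auto simp: loaded_def)
  obtain r1 where eval: "runs ?l (pc, r, inp, out) (pc + ?l, r1, inp, out)"
      "r1 d = ?v" "\<forall>y<d. r1 y = r y" "represents r1 \<sigma>"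
    using loaded_exp_runs[OF repr _ _ code(1)] size by auto
  note eval(1)
  also have "runs 1 (pc + ?l, r1, inp, out) (pc + ?l + 1, r1, inp, out @ [?v])"
    using code(2) size registers_le eval(2) eval_le_power_Z[OF repr, of e]
    by (intro runs_instr[of _ "Write d"]) (auto intro!: le_power_Z)
  finally have "runs (2 * Z + 4) (pc, r, inp, out) (pc + ?l + 1, r1, inp, out @ [?v])"
    using runs_mono length_compile_exp_le[of e d] size by fastforce
  then show "\<exists>r'. simulates (Output e) (\<sigma>, inp, out) pc d r r'"
    using eval(3,4) by (intro exI[of _ r1]) (simp add: simulates_def add.assoc)
qed

lemma implemented_Seq:
  assumes "implemented c1" "implemented c2"
  shows "implemented (c1 ;; c2)"
proof (rule implementedI)
  fix pc d r and \<sigma> :: "nat \<Rightarrow> nat" and inp out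
  let ?s = "(\<sigma>, inp, out) :: state" and ?s1 = "exec c1 (\<sigma>, inp, out)"
  let ?pc1 = "pc + length (compile c1 pc d)"
  assume "loaded (c1 ;; c2) pc d" and repr: "represents r \<sigma>"
    and bound: "stores_at_most X (c1 ;; c2) ?s"
  then have loaded: "loaded c1 pc d" "loaded c2 ?pc1 d" by (auto simp: loaded_def Let_def)
  obtain r1 where first: "simulates c1 ?s pc d r r1"
    using implementedE[OF assms(1) loaded(1), of r ?s] repr bound by auto
  then obtain r2 where second: "simulates c2 ?s1 ?pc1 d r1 r2"
    using implementedE[OF assms(2) loaded(2), of r1 ?s1] bound by (auto simp: simulates_def)
  have "runs (steps (c1 ;; c2) ?s * (2 * Z + 4)) (pc, r, inp, out)
      (pc + length (compile (c1 ;; c2) pc d), r2, snd (exec (c1 ;; c2) ?s))"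
    using runs_trans[of _ "(pc, r, inp, out)" "(?pc1, r1, snd ?s1)"] first second
    by (simp add: simulates_def Let_def add.assoc add_mult_distrib)
  then show "\<exists>r'. simulates (c1 ;; c2) ?s pc d r r'"
    using first second by (intro exI[of _ r2]) (simp add: simulates_def)
qed

lemma runs_repeat_iteration:
  fixes s :: state
  assumes body: "implemented c" "loaded c (l + 1) (d + 1)" and scratch: "Z \<le> d"
    and code: "code_at p l [JZero d l']"
      "code_at p (l + 1 + length (compile c (l + 1) (d + 1)))
        [Const (d + 1) 1, Sub d d (d + 1), Jump l]"
    and init: "represents r (fst s)" "stores_at_most X c s" "r d = Suc q" "Suc q \<le> X ^ Z"
  shows "\<exists>r'. runs ((steps c s + 1) * (2 * Z + 4)) (l, r, snd s) (l, r', snd (exec c s)) \<and>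
     represents r' (fst (exec c s)) \<and> r' d = q \<and> (\<forall>y. Z \<le> y \<and> y < d \<longrightarrow> r' y = r y)"
proof -
  obtain inp out where conf: "snd s = (inp, out)" by fastforce
  obtain inp' out' where conf': "snd (exec c s) = (inp', out')" by fastforce
  let ?n = "l + 1 + length (compile c (l + 1) (d + 1))"
  have size: "d + 1 \<le> 2 * Z" using body(2) by (simp add: loaded_def)
  obtain r1 where body_run: "runs (steps c s * (2 * Z + 4)) (l + 1, r, inp, out)
    (?n, r1, inp', out')"
      "represents r1 (fst (exec c s))" "\<forall>y. Z \<le> y \<and> y < d + 1 \<longrightarrow> r1 y = r y"
    using implementedE[OF body init(1,2)] unfolding simulates_def conf conf' by metis
  let ?r2 = "r1(d + 1 := 1)" and ?r3 = "r1(d + 1 := 1, d := q)"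
  have "runs 1 (l, r, inp, out) (l + 1, r, inp, out)"
    using code(1) size registers_le init(3,4)
    by (intro runs_instr[of _ "JZero d l'"]) (auto intro!: le_power_Z)
  also note body_run(1)
  also have "runs 1 (?n, r1, inp', out') (?n + 1, ?r2, inp', out')"
    using code(2) size registers_le by (intro runs_instr) (auto intro!: le_power_Z)
  also have "runs 1 (?n + 1, ?r2, inp', out') (?n + 2, ?r3, inp', out')"
    using code(2) size registers_le init(3,4) body_run(3) scratch
    by (intro runs_instr[of _ "Sub d d (d + 1)"]) (auto intro!: le_power_Z)
  also have "runs 1 (?n + 2, ?r3, inp', out') (l, ?r3, inp', out')"
    using code(2) by (intro runs_instr[of _ "Jump l"]) auto
  finally have "runs ((steps c s + 1) * (2 * Z + 4)) (l, r, snd s) (l, ?r3, snd (exec c s))"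
    unfolding conf conf' by (rule runs_mono) simp
  moreover have "represents ?r3 (fst (exec c s))"
    using scratch by (intro represents_cong[OF body_run(2)]) simp
  ultimately show ?thesis using body_run(3) by (intro exI[of _ ?r3]) simp
qed

lemma runs_repeat_loop:
  fixes s :: state
  assumes body: "implemented c" "loaded c (l + 1) (d + 1)" and scratch: "Z \<le> d"
    and code: "code_at p l [JZero d l']"
      "code_at p (l + 1 + length (compile c (l + 1) (d + 1)))
        [Const (d + 1) 1, Sub d d (d + 1), Jump l]"
    and init: "represents r (fst s)" "\<forall>j<q. stores_at_most X c ((exec c ^^ j) s)"
      "r d = q" "q \<le> X ^ Z"
  shows "\<exists>r'. runs ((\<Sum>j<q. steps c ((exec c ^^ j) s) + 1) * (2 * Z + 4)) (l, r, snd s)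
        (l, r', snd ((exec c ^^ q) s)) \<and>
     represents r' (fst ((exec c ^^ q) s)) \<and> r' d = 0 \<and> (\<forall>y. Z \<le> y \<and> y < d \<longrightarrow> r' y = r y)"
  using init
proof (induction q arbitrary: r s)
  case 0
  then show ?case using runs_refl by (intro exI[of _ r]) simp
next
  case (Suc q)
  have "stores_at_most X c s" using Suc.prems(2) by force
  then obtain r1 where first: "runs ((steps c s + 1) * (2 * Z + 4)) (l, r, snd s)
    (l, r1, snd (exec c s))"
      "represents r1 (fst (exec c s))" "r1 d = q" "\<forall>y. Z \<le> y \<and> y < d \<longrightarrow> r1 y = r y"
    using runs_repeat_iteration[OF body scratch code Suc.prems(1) _ Suc.prems(3,4)] by blast
  have "\<forall>j<q. stores_at_most X c ((exec c ^^ j) (exec c s))"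
    using Suc.prems(2) by (metis Suc_less_eq funpow_simps_right(2) o_apply)
  then obtain r2 where rest: "runs ((\<Sum>j<q. steps c ((exec c ^^ j) (exec c s)) + 1) * (2 * Z + 4))
        (l, r1, snd (exec c s)) (l, r2, snd ((exec c ^^ q) (exec c s)))"
      "represents r2 (fst ((exec c ^^ q) (exec c s)))" "r2 d = 0"
      "\<forall>y. Z \<le> y \<and> y < d \<longrightarrow> r2 y = r1 y"
    using Suc.IH[OF first(2) _ first(3)] Suc.prems(4) by auto
  have "(\<Sum>j<Suc q. steps c ((exec c ^^ j) s) + 1) =
      steps c s + 1 + (\<Sum>j<q. steps c ((exec c ^^ j) (exec c s)) + 1)"
    unfolding sum.lessThan_Suc_shift by (simp add: funpow_swap1)
  then show ?case
    using runs_trans[OF first(1) rest(1)] rest first(4)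
    by (intro exI[of _ r2]) (simp add: funpow_swap1 algebra_simps)
qed

lemma implemented_Repeat:
  assumes "implemented c"
  shows "implemented (Repeat e c)"
proof (rule implementedI)
  fix pc d r and \<sigma> :: "nat \<Rightarrow> nat" and inp out
  let ?c = "Repeat e c" and ?s = "(\<sigma>, inp, out) :: state" and ?h = "length (compile_exp e d)"
  let ?l = "pc + ?h" and ?S = "\<Sum>j<eval e \<sigma>. steps c ((exec c ^^ j) ?s) + 1"
  let ?b = "length (compile c (?l + 1) (d + 1))" and ?s' = "snd (exec (Repeat e c) ?s)"
  let ?l' = "?l + ?b + 4"
  assume "loaded ?c pc d" and repr: "represents r \<sigma>" and bound: "stores_at_most X ?c ?s"
  then have body: "loaded c (?l + 1) (d + 1)"
    and size: "Z \<le> d" "d + esize e + 1 \<le> 2 * Z" "esize e \<le> Z"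
    and code: "code_at p pc (compile_exp e d)" "code_at p ?l [JZero d ?l']"
      "code_at p (?l + 1 + ?b) [Const (d + 1) 1, Sub d d (d + 1), Jump ?l]"
    by (auto simp: loaded_def Let_def)
  obtain r1 where eval: "runs ?h (pc, r, inp, out) (?l, r1, inp, out)"
      "r1 d = eval e \<sigma>" "\<forall>y<d. r1 y = r y" "represents r1 \<sigma>"
    using loaded_exp_runs[OF repr _ _ code(1)] size by auto
  obtain r2 where loop: "runs (?S * (2 * Z + 4)) (?l, r1, inp, out) (?l, r2, ?s')"
      "represents r2 (fst (exec ?c ?s))" "r2 d = 0" "\<forall>y. Z \<le> y \<and> y < d \<longrightarrow> r2 y = r1 y"
    using runs_repeat_loop[OF assms body size(1) code(2,3), of r1 ?s "eval e \<sigma>"]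
      eval_le_power_Z[OF repr size(3)] eval(2,4) bound by auto
  obtain inp' out' where conf': "?s' = (inp', out')" by fastforce
  have exit: "runs 1 (?l, r2, ?s') (?l', r2, ?s')"
    unfolding conf' using code(2) size registers_le loop(3)
    by (intro runs_instr[of _ "JZero d ?l'"]) (auto intro!: le_power_Z)
  note eval(1)
  also note loop(1)
  also note exit
  also have "?l' = pc + length (compile ?c pc d)" by (simp add: Let_def)
  finally have "runs (steps ?c ?s * (2 * Z + 4)) (pc, r, inp, out)
      (pc + length (compile ?c pc d), r2, ?s')"
    by (rule runs_mono) (use length_compile_exp_le[of e d] size in simp)
  then show "\<exists>r'. simulates ?c ?s pc d r r'"
    using loop(2,4) eval(3) by (intro exI[of _ r2]) (simp add: simulates_def)
qed

lemma compile_correct: "implemented c"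
  by (induction c)
    (auto intro: implemented_Assign implemented_Input implemented_Output implemented_Seq
      implemented_Repeat)

end

section \<open>Hoare triples with step counts\<close>

type_synonym assertion = "state \<Rightarrow> bool"

definition hoare :: "nat \<Rightarrow> assertion \<Rightarrow> cmd \<Rightarrow> nat \<Rightarrow> assertion \<Rightarrow> bool" where
  "hoare X P c k Q \<longleftrightarrow>
     (\<forall>s. P s \<longrightarrow> Q (exec c s) \<and> steps c s \<le> k \<and> stores_at_most X c s)"

lemma hoare_Seq:
  "hoare X P c1 k1 Q \<Longrightarrow> hoare X Q c2 k2 R \<Longrightarrow> hoare X P (c1 ;; c2) (k1 + k2) R"
  unfolding hoare_def by (simp add: add_le_mono del: split_paired_All)

lemma hoare_weaken:
  assumes "hoare X P c k Q" "\<And>s. P' s \<Longrightarrow> P s" "\<And>s. Q s \<Longrightarrow> Q' s" "k \<le> k'"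
  shows "hoare X P' c k' Q'"
  using assms unfolding hoare_def by (meson le_trans)

lemma hoare_Repeat:
  assumes count: "\<And>s. I 0 s \<Longrightarrow> eval e (fst s) = m"
    and body: "\<And>j. j < m \<Longrightarrow> hoare X (I j) c k (I (Suc j))"
  shows "hoare X (I 0) (Repeat e c) (m * (k + 1) + 1) (I m)"
  unfolding hoare_def
proof (intro allI impI)
  fix s assume start: "I 0 s"
  have inv: "I j ((exec c ^^ j) s)" if "j \<le> m" for j
    using that
  proof (induction j)
    case (Suc j)
    then show ?case using body[of j] by (simp add: hoare_def del: split_paired_All)
  qed (simp add: start)
  then have iter: "steps c ((exec c ^^ j) s) \<le> k \<and> stores_at_most X c ((exec c ^^ j) s)"
    if "j < m" for j
    using that body[OF that] by (simp add: hoare_def del: split_paired_All)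
  then have "(\<Sum>j<m. steps c ((exec c ^^ j) s) + 1) \<le> m * (k + 1)"
    using sum_bounded_above[of "{..<m}" "\<lambda>j. steps c ((exec c ^^ j) s) + 1" "k + 1"] by simp
  then show "I m (exec (Repeat e c) s) \<and> steps (Repeat e c) s \<le> m * (k + 1) + 1 \<and>
      stores_at_most X (Repeat e c) s"
    using inv[of m] iter by (simp add: count[OF start])
qed

definition binds :: "(nat \<Rightarrow> nat) \<Rightarrow> (nat \<times> nat) list \<Rightarrow> bool" where
  "binds \<sigma> vs \<longleftrightarrow> (\<forall>(x, v) \<in> set vs. \<sigma> x = v)"

lemma binds_simps [simp]:
  "binds \<sigma> []" "binds \<sigma> ((x, v) # vs) \<longleftrightarrow> \<sigma> x = v \<and> binds \<sigma> vs"
  by (auto simp: binds_def)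

lemma binds_upd [simp]: "x \<notin> fst ` set vs \<Longrightarrow> binds (\<sigma>(x := a)) vs \<longleftrightarrow> binds \<sigma> vs"
  by (force simp: binds_def)

definition state_at :: "(nat \<times> nat) list \<Rightarrow> nat list \<Rightarrow> nat list \<Rightarrow> assertion" where
  "state_at vs inp out = (\<lambda>(\<sigma>, i, o'). binds \<sigma> vs \<and> i = inp \<and> o' = out)"

lemma hoare_Repeat_list:
  assumes count: "\<And>\<sigma>. binds \<sigma> vs \<Longrightarrow> eval e \<sigma> = length xs"
    and body: "\<And>x rest out. x \<in> set xs \<Longrightarrow>
      hoare X (state_at vs (g x @ rest) out) c k (state_at vs rest (out @ f x))"
  shows "hoare X (state_at vs (concat (map g xs) @ rest) out) (Repeat e c) (length xs * (k + 1) + 1)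
           (state_at vs rest (out @ concat (map f xs)))"
proof -
  let ?I = "\<lambda>j. state_at vs (concat (map g (drop j xs)) @ rest) (out @ concat (map f (take j xs)))"
  have "hoare X (?I 0) (Repeat e c) (length xs * (k + 1) + 1) (?I (length xs))"
  proof (rule hoare_Repeat[where I = ?I])
    fix j assume j: "j < length xs"
    have "drop j xs = xs ! j # drop (Suc j) xs" "take (Suc j) xs = take j xs @ [xs ! j]"
      using j by (simp_all add: Cons_nth_drop_Suc take_Suc_conv_app_nth)
    then show "hoare X (?I j) c k (?I (Suc j))"
      using body[of "xs ! j" "concat (map g (drop (Suc j) xs)) @ rest"
          "out @ concat (map f (take j xs))"] j by simp
  qed (use count in \<open>auto simp: state_at_def\<close>)
  then show ?thesis by simp
qed

abbreviation For :: "nat \<Rightarrow> aexp \<Rightarrow> cmd \<Rightarrow> cmd" where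
  "For x e c \<equiv> Assign x (Num 0) ;; Repeat e (c ;; Assign x (Bin Plus (Var x) (Num 1)))"

lemma hoare_For:
  assumes count: "\<And>\<sigma>. binds \<sigma> vs \<Longrightarrow> eval e \<sigma> = m"
    and fresh: "x \<notin> fst ` set vs" and bound: "m \<le> X"
    and body: "\<And>j out. j < m \<Longrightarrow>
      hoare X (state_at ((x, j) # vs) inp out) c k (state_at ((x, j) # vs) inp (out @ f j))"
  shows "hoare X (state_at vs inp out) (For x e c) (m * (k + 2) + 2)
           (state_at vs inp (out @ concat (map f [0..<m])))"
proof -
  let ?I = "\<lambda>j. state_at ((x, j) # vs) inp (out @ concat (map f [0..<j]))"
  have init: "hoare X (state_at vs inp out) (Assign x (Num 0)) 1 (?I 0)"
    using fresh by (auto simp: hoare_def state_at_def)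
  have "hoare X (?I 0) (Repeat e (c ;; Assign x (Bin Plus (Var x) (Num 1))))
    (m * (k + 1 + 1) + 1) (?I m)"
  proof (rule hoare_Repeat[where I = ?I])
    fix j assume j: "j < m"
    let ?J = "state_at ((x, j) # vs) inp (out @ concat (map f [0..<Suc j]))"
    have "hoare X (?I j) c k ?J" using body[OF j, of "out @ concat (map f [0..<j])"] by simp
    moreover have "hoare X ?J (Assign x (Bin Plus (Var x) (Num 1))) 1 (?I (Suc j))"
      using fresh bound j by (auto simp: hoare_def state_at_def)
    ultimately show "hoare X (?I j) (c ;; Assign x (Bin Plus (Var x) (Num 1))) (k + 1) (?I (Suc j))"
      by (rule hoare_Seq)
  qed (auto simp: state_at_def count)
  from hoare_Seq[OF init this] show ?thesis by (rule hoare_weaken) (auto simp: state_at_def)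
qed

lemma hoare_ram_computes:
  assumes "hoare X (\<lambda>s. s = (\<lambda>_. 0, xs, [])) c k (\<lambda>s. snd (snd s) = ys)"
    and "Z = csize c" "2 * Z + 2 \<le> X"
  shows "\<exists>t. ram_computes (compile c 0 Z) xs ys t \<and> t \<le> k * (2 * Z + 4) * (5 * len (X ^ Z))"
proof -
  let ?p = "compile c 0 Z" and ?s = "(\<lambda>_. 0, xs, []) :: state"
  interpret ram_program ?p Z X using assms(2,3) csize_pos by unfold_locales simp_all
  have triple: "snd (snd (exec c ?s)) = ys" "steps c ?s \<le> k" "stores_at_most X c ?s"
    using assms(1) by (auto simp: hoare_def)
  obtain inp' where final: "snd (exec c ?s) = (inp', ys)" using triple(1) by (metis prod.collapse)
  have "loaded c 0 Z"
    unfolding loaded_def code_at_def using assms(2) by simp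
  moreover have "represents (\<lambda>_. 0) (fst ?s)" by (simp add: represents_def)
  ultimately obtain r' where "simulates c ?s 0 Z (\<lambda>_. 0) r'"
    using implementedE[OF compile_correct] triple(3) by blast
  then have "runs (steps c ?s * (2 * Z + 4)) (0, \<lambda>_. 0, xs, []) (length ?p, r', inp', ys)"
    by (simp add: simulates_def final)
  then have "runs (k * (2 * Z + 4)) (0, \<lambda>_. 0, xs, []) (length ?p, r', inp', ys)"
    using triple(2) by (elim runs_mono) simp
  then show ?thesis unfolding runs_def ram_computes_def by blast
qed

section \<open>Branching programs for transition systems that query the input\<close>

inductive bp_reach :: "bp \<Rightarrow> bool list \<Rightarrow> nat \<Rightarrow> nat \<Rightarrow> bool" for P y where
  start: "bp_reach P y 0 0"
| step: "bp_reach P y i u \<Longrightarrow> (i, u, v, y ! bp_label P i) \<in> bp_edges P \<Longrightarrow> bp_reach P y (Suc i) v"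

lemma bp_reach_iff_path:
  "bp_reach P y i u \<longleftrightarrow>
     (\<exists>p. p 0 = 0 \<and> p i = u \<and> (\<forall>k<i. (k, p k, p (k + 1), y ! bp_label P k) \<in> bp_edges P))"
proof
  assume "bp_reach P y i u"
  then show "\<exists>p. p 0 = 0 \<and> p i = u \<and>
      (\<forall>k<i. (k, p k, p (k + 1), y ! bp_label P k) \<in> bp_edges P)"
  proof (induction rule: bp_reach.induct)
    case (step i u v)
    then obtain p where path: "p 0 = 0" "p i = u"
      "\<forall>k<i. (k, p k, p (k + 1), y ! bp_label P k) \<in> bp_edges P" by blast
    then show ?case using step.hyps by (intro exI[of _ "p(Suc i := v)"]) (auto simp: less_Suc_eq)
  qed (auto intro: exI[of _ "\<lambda>_. 0"])
next
  assume "\<exists>p. p 0 = 0 \<and> p i = u \<and>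
      (\<forall>k<i. (k, p k, p (k + 1), y ! bp_label P k) \<in> bp_edges P)"
  then obtain p where path: "p 0 = 0" "p i = u"
    "\<And>k. k < i \<Longrightarrow> (k, p k, p (k + 1), y ! bp_label P k) \<in> bp_edges P" by blast
  have "bp_reach P y k (p k)" if "k \<le> i" for k
    using that
  proof (induction k)
    case 0
    show ?case unfolding path(1) by (rule bp_reach.start)
  next
    case (Suc k)
    then show ?case using bp_reach.step[OF Suc.IH] path(3)[of k] by simp
  qed
  from this[of i] show "bp_reach P y i u" using path(2) by simp
qed

lemma bp_accepts_iff_reach:
  "bp_accepts P y \<longleftrightarrow> bp_reach P y (bp_length P - 1) 0"
  unfolding bp_accepts_def bp_reach_iff_path by (simp add: less_diff_conv)

lemma ex_congruent_in_block:
  fixes j z a :: nat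
  assumes "j < z"
  obtains i where "a \<le> i" "i < a + z" "i mod z = j"
proof
  let ?i = "a + (j + z - a mod z) mod z"
  have "?i mod z = (a mod z + (j + z - a mod z)) mod z" by (simp add: mod_simps)
  also have "a mod z + (j + z - a mod z) = j + z"
    using mod_less_divisor[of z a] assms by linarith
  finally show "?i mod z = j" using assms by simp
qed (use assms in auto)

text \<open>
  The program sweeps over all \<open>z\<close> variables \<open>W\<^sup>2\<close> times; a node of \<open>{..<W}\<close> may stall in every
  layer and make a step that depends on variable \<open>j\<close> in a layer that reads \<open>j\<close>. Node 0 is no
  state of the transition system: it is the source in layer 0, and a sink in all later layers.
\<close>

definition sweep_edge :: "nat \<Rightarrow> nat \<Rightarrow> (nat \<Rightarrow> bool) \<Rightarrow> (nat \<Rightarrow> bool \<Rightarrow> nat \<Rightarrow> nat \<Rightarrow> bool) \<Rightarrow>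
    nat \<Rightarrow> nat \<Rightarrow> nat \<Rightarrow> bool \<Rightarrow> bool" where
  "sweep_edge z s acc step i u v m \<longleftrightarrow>
     (if i = 0 then u = 0 \<and> v = s
      else u = v \<or> v = 0 \<and> acc u \<or> step (i mod z) m u v)"

definition sweep_layers :: "nat \<Rightarrow> nat \<Rightarrow> nat" where
  "sweep_layers z W = 2 + z * W ^ 2"

definition sweep_bp :: "nat \<Rightarrow> nat \<Rightarrow> nat \<Rightarrow> (nat \<Rightarrow> bool) \<Rightarrow>
    (nat \<Rightarrow> bool \<Rightarrow> nat \<Rightarrow> nat \<Rightarrow> bool) \<Rightarrow> bp" where
  "sweep_bp z W s acc step =
     \<lparr>bp_inputs = z, bp_length = sweep_layers z W + 1, bp_width = W, bp_label = (\<lambda>i. i mod z),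
      bp_edges = {(i, u, v, m). i < sweep_layers z W \<and> u < W \<and> v < W \<and>
        sweep_edge z s acc step i u v m}\<rparr>"

lemma wf_sweep_bp: "0 < z \<Longrightarrow> 0 < W \<Longrightarrow> wf_bp (sweep_bp z W s acc step)"
  by (auto simp: wf_bp_def sweep_bp_def)

lemma bp_size_sweep_bp_le: "bp_size (sweep_bp z W s acc step) \<le> 2 * sweep_layers z W * W ^ 2"
proof -
  have "bp_edges (sweep_bp z W s acc step) \<subseteq> {..<sweep_layers z W} \<times> {..<W} \<times> {..<W} \<times> UNIV"
    by (auto simp: sweep_bp_def)
  from card_mono[OF _ this] show ?thesis
    by (simp add: bp_size_def card_cartesian_product UNIV_bool power2_eq_square algebra_simps)
qed

definition query_step :: "nat \<Rightarrow> (nat \<Rightarrow> bool \<Rightarrow> nat \<Rightarrow> nat \<Rightarrow> bool) \<Rightarrow> bool list \<Rightarrow> nat \<Rightarrow> nat \<Rightarrow> bool"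
where
  "query_step z step y u v \<longleftrightarrow> (\<exists>j<z. step j (y ! j) u v)"

locale sweep =
  fixes z W s :: nat and acc :: "nat \<Rightarrow> bool" and step :: "nat \<Rightarrow> bool \<Rightarrow> nat \<Rightarrow> nat \<Rightarrow> bool"
    and y :: "bool list"
  assumes z_pos: "0 < z"
    and reachable: "(query_step z step y)\<^sup>*\<^sup>* s u \<Longrightarrow> 0 < u \<and> u < W"
begin

abbreviation "run_step \<equiv> query_step z step y"
abbreviation "P \<equiv> sweep_bp z W s acc step"
abbreviation "E \<equiv> sweep_layers z W"

lemma W_pos: "0 < W"
  using reachable by fastforce

lemma sweep_accepts_iff: "bp_accepts P y \<longleftrightarrow> bp_reach P y E 0"
  by (simp add: bp_accepts_iff_reach sweep_bp_def)

lemma reach_edge: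
  "bp_reach P y i u \<Longrightarrow> i < E \<Longrightarrow> u < W \<Longrightarrow> v < W \<Longrightarrow>
     sweep_edge z s acc step i u v (y ! (i mod z)) \<Longrightarrow> bp_reach P y (Suc i) v"
  using bp_reach.step[of P y i u v] by (simp add: sweep_bp_def)

lemma sweep_bp_sound:
  assumes "bp_accepts P y"
  shows "\<exists>u. run_step\<^sup>*\<^sup>* s u \<and> acc u"
proof (rule ccontr)
  assume rejecting: "\<not> ?thesis"
  have "if i = 0 then u = 0 else run_step\<^sup>*\<^sup>* s u" if "bp_reach P y i u" for i u
    using that
  proof (induction rule: bp_reach.induct)
    case (step i u v)
    have edge: "sweep_edge z s acc step i u v (y ! (i mod z))"
      using step.hyps by (auto simp: sweep_bp_def)
    show ?case
    proof (cases "i = 0")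
      case True
      then show ?thesis using edge by (simp add: sweep_edge_def)
    next
      case False
      then have "run_step\<^sup>*\<^sup>* s u" using step.IH by simp
      moreover from this have "u = v \<or> run_step u v"
        using edge False rejecting z_pos by (auto simp: sweep_edge_def query_step_def)
      ultimately show ?thesis by auto
    qed
  qed simp
  from this[of E 0] show False
    using assms reachable[of 0] by (auto simp: sweep_accepts_iff sweep_layers_def)
qed

lemma reach_stall:
  assumes "bp_reach P y a u" "0 < a" "a \<le> b" "b \<le> E" "u < W"
  shows "bp_reach P y b u"
  using assms(3,4)
proof (induction b rule: dec_induct)
  case (step b)
  then show ?case using reach_edge[of b u u] assms by (simp add: sweep_edge_def)
qed (use assms in simp)

lemma reach_sweep:
  assumes reach: "bp_reach P y a u" "0 < a" "a + z \<le> E" and move: "run_step u v" "u < W" "v < W"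
  shows "bp_reach P y (a + z) v"
proof -
  obtain j where query: "j < z" "step j (y ! j) u v" using move(1) by (auto simp: query_step_def)
  obtain i where block: "a \<le> i" "i < a + z" "i mod z = j"
    by (rule ex_congruent_in_block[OF query(1)])
  have "bp_reach P y i u" using reach_stall[OF reach(1,2)] block reach(3) move(2) by simp
  then have "bp_reach P y (Suc i) v"
    using reach_edge[of i u v] block reach(2,3) move query(2) by (auto simp: sweep_edge_def)
  then show ?thesis using reach_stall block reach(3) move(3) by simp
qed

lemma reach_sweeps:
  assumes "(run_step ^^ t) s u" "t \<le> W ^ 2"
  shows "bp_reach P y (1 + t * z) u"
  using assms
proof (induction t arbitrary: u)
  case 0
  have "bp_reach P y (Suc 0) s"
    using reach_edge[OF bp_reach.start] W_pos reachable[of s]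
    by (simp add: sweep_edge_def sweep_layers_def)
  then show ?case using 0 by simp
next
  case (Suc t)
  then obtain u' where last_step: "(run_step ^^ t) s u'" "run_step u' u" by auto
  then have reach: "run_step\<^sup>*\<^sup>* s u'" "run_step\<^sup>*\<^sup>* s u"
    by (auto dest: relpowp_imp_rtranclp)
  have "(t + 1) * z \<le> W ^ 2 * z" using Suc.prems by (intro mult_le_mono1) simp
  then have "1 + t * z + z \<le> E" by (simp add: sweep_layers_def mult.commute)
  then have "bp_reach P y (1 + t * z + z) u"
    using reach_sweep[OF Suc.IH[OF last_step(1)]] last_step(2) reachable reach Suc.prems by simp
  then show ?case by (simp add: add_ac)
qed

lemma ex_short_run:
  assumes "run_step\<^sup>*\<^sup>* s u"
  obtains t where "t \<le> W ^ 2" "(run_step ^^ t) s u"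
proof -
  define R where "R = {(u, v). run_step\<^sup>*\<^sup>* s u \<and> run_step u v}"
  have "R \<subseteq> {..<W} \<times> {..<W}"
    using reachable by (auto simp: R_def intro: rtranclp.rtrancl_into_rtrancl)
  then have finite_R: "finite R" "card R \<le> W ^ 2"
    using finite_subset card_mono[of "{..<W} \<times> {..<W}" R]
    by (auto simp: card_cartesian_product power2_eq_square)
  have "(s, u) \<in> R\<^sup>*"
    using assms
  proof (induction rule: rtranclp_induct)
    case (step u v)
    then have "(u, v) \<in> R" by (simp add: R_def)
    with step.IH show ?case by (rule rtrancl_into_rtrancl)
  qed simp
  then obtain t where walk: "t \<le> card R" "(s, u) \<in> R ^^ t"
    unfolding rtrancl_finite_eq_relpow[OF finite_R(1)] by blast
  have "(run_step ^^ k) s v" if "(s, v) \<in> R ^^ k" for k v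
    using that by (induction k arbitrary: v) (auto simp: R_def)
  from that[OF le_trans[OF walk(1) finite_R(2)] this[OF walk(2)]] show thesis .
qed

lemma sweep_bp_complete:
  assumes "run_step\<^sup>*\<^sup>* s u" "acc u"
  shows "bp_accepts P y"
proof -
  obtain t where run: "t \<le> W ^ 2" "(run_step ^^ t) s u" using ex_short_run[OF assms(1)] .
  have "1 + t * z \<le> E - 1"
    using mult_le_mono1[OF run(1), of z] by (simp add: sweep_layers_def mult.commute)
  then have "bp_reach P y (E - 1) u"
    using reach_stall[OF reach_sweeps[OF run(2,1)]] reachable[OF assms(1)] by simp
  then have "bp_reach P y (Suc (E - 1)) 0"
    using reach_edge[of "E - 1" u 0] assms(2) reachable[OF assms(1)] W_pos
    by (simp add: sweep_edge_def sweep_layers_def)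
  then show ?thesis by (simp add: sweep_accepts_iff sweep_layers_def)
qed

lemma sweep_bp_accepts_iff: "bp_accepts P y \<longleftrightarrow> (\<exists>u. run_step\<^sup>*\<^sup>* s u \<and> acc u)"
  using sweep_bp_sound sweep_bp_complete by blast

end

section \<open>Simulation of bounded-space machines\<close>

definition tape_code :: "nat \<Rightarrow> nat \<Rightarrow> (nat \<Rightarrow> nat) \<Rightarrow> nat" where
  "tape_code G S w = (\<Sum>k<S. w k * G ^ k)"

lemma digit_add_less:
  fixes a b c K :: nat
  assumes "a < K" "b < c"
  shows "a + K * b < K * c"
proof -
  have "a + K * b < K * Suc b" using assms(1) by simp
  also have "\<dots> \<le> K * c" using assms(2) by (intro mult_le_mono2) simp
  finally show ?thesis .
qed

lemma tape_code_less:
  assumes "\<And>k. w k < G"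
  shows "tape_code G S w < G ^ S"
proof (induction S)
  case (Suc S)
  have "tape_code G S w + G ^ S * w S < G ^ S * G" using Suc assms by (rule digit_add_less)
  then show ?case by (simp add: tape_code_def mult.commute)
qed (simp add: tape_code_def)

lemma tape_code_digit:
  assumes digits: "\<And>k. w k < G" and in_tape: "h < S"
  shows "tape_code G S w div G ^ h mod G = w h"
  using in_tape
proof (induction S)
  case (Suc S)
  have G_pos: "G > 0" using digits[of 0] by simp
  show ?case
  proof (cases "h = S")
    case True
    have "tape_code G (Suc S) w div G ^ S = w S"
      using tape_code_less[OF digits, of S] G_pos by (simp add: tape_code_def)
    then show ?thesis using True digits by simp
  next
    case False
    then have below: "h < S" using Suc by simp
    then obtain t where S_eq: "S = h + Suc t" using less_imp_Suc_add by (metis add_Suc_right)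
    have "tape_code G (Suc S) w = tape_code G S w + G ^ h * (G * (w S * G ^ t))"
      by (simp add: tape_code_def S_eq power_add)
    then have "tape_code G (Suc S) w div G ^ h = tape_code G S w div G ^ h + G * (w S * G ^ t)"
      using G_pos by simp
    then show ?thesis using Suc.IH below by simp
  qed
qed simp

lemma tape_code_upd:
  assumes "h < S"
  shows "tape_code G S (w(h := g)) = tape_code G S w + g * G ^ h - w h * G ^ h"
proof -
  have "tape_code G S v = v h * G ^ h + (\<Sum>k\<in>{..<S} - {h}. v k * G ^ k)" for v
    unfolding tape_code_def using assms by (subst sum.remove[of _ h]) auto
  from this[of w] this[of "w(h := g)"] show ?thesis by simp
qed

text \<open>
  The work head position \<open>h\<close> is represented by the power \<open>G ^ h\<close>, so that the scanned symbol can
  be read and overwritten without exponentiation.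
\<close>

fun conf_code :: "nat \<Rightarrow> nat \<Rightarrow> nat \<Rightarrow> ntm_conf \<Rightarrow> nat" where
  "conf_code K G S (q, i, h, w) = q + K * (i + K * (G ^ h + K * tape_code G S w))"

lemma conf_code_decode:
  fixes S :: nat and w :: "nat \<Rightarrow> nat"
  assumes "q < K" "i < K" "G ^ h < K"
  defines "u \<equiv> conf_code K G S (q, i, h, w)"
  shows "u mod K = q" "u div K mod K = i" "u div K div K mod K = G ^ h"
    "u div K div K div K = tape_code G S w"
  unfolding u_def using assms by auto

lemma conf_code_less:
  assumes "q < K" "i < K" "G ^ h < K" "tape_code G S w < K"
  shows "conf_code K G S (q, i, h, w) < K ^ 4"
proof -
  have "conf_code K G S (q, i, h, w) < K * (K * (K * K))"
    unfolding conf_code.simps using assms by (intro digit_add_less)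
  then show ?thesis by (simp add: numeral_eq_Suc)
qed

fun power_move :: "nat \<Rightarrow> dir \<Rightarrow> nat \<Rightarrow> nat" where
  "power_move G MoveL P = max (P div G) 1"
| "power_move G Stay P = P"
| "power_move G MoveR P = P * G"

lemma power_move: "power_move G d (G ^ h) = G ^ move d h" if "2 \<le> G"
proof (cases d)
  case MoveL
  have "max (G ^ k) 1 = G ^ k" for k using that by (intro max_absorb1) simp
  then show ?thesis using MoveL that by (cases h) simp_all
qed simp_all

text \<open>The symbol in cell \<open>j\<close> of an input tape with \<open>z\<close> cells, if \<open>m\<close> is the bit there.\<close>

definition scanned :: "nat \<Rightarrow> nat \<Rightarrow> bool \<Rightarrow> insym" where
  "scanned z j m = (if j = 0 then LeftEnd else if j < z - 1 then Bit m else RightEnd)"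

type_synonym transition = "nat \<times> insym \<times> nat \<times> nat \<times> nat \<times> dir \<times> dir"

fun trans_edge :: "nat \<Rightarrow> nat \<Rightarrow> nat \<Rightarrow> transition \<Rightarrow> nat \<Rightarrow> bool \<Rightarrow> nat \<Rightarrow> nat \<Rightarrow> bool" where
  "trans_edge K G z (q, s, g, q', g', d, d') j m u v \<longleftrightarrow>
     (let i = u div K mod K; P = u div K div K mod K; w = u div K div K div K
      in u mod K = q \<and> i = j \<and> s = scanned z j m \<and> w div P mod G = g \<and>
         v = q' + K * (min (move d i) (z - 1) +
           K * (power_move G d' P + K * (w + g' * P - g * P))))"

definition radix :: "nat \<Rightarrow> nat \<Rightarrow> nat \<Rightarrow> nat" where
  "radix B S n = (2 * n + 2 + B) * B ^ S"

definition width :: "nat \<Rightarrow> nat \<Rightarrow> nat \<Rightarrow> nat" where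
  "width B S n = radix B S n ^ 4"

definition layers :: "nat \<Rightarrow> nat \<Rightarrow> nat \<Rightarrow> nat" where
  "layers B S n = sweep_layers (2 * n + 2) (width B S n)"

definition machine_step :: "ntm \<Rightarrow> nat \<Rightarrow> nat \<Rightarrow> nat \<Rightarrow> nat \<Rightarrow> bool \<Rightarrow> nat \<Rightarrow> nat \<Rightarrow> bool" where
  "machine_step M K G z j m u v \<longleftrightarrow> (\<exists>tr\<in>ntm_delta M. trans_edge K G z tr j m u v)"

text \<open>The code of the initial configuration is \<open>ntm_start M + K * K\<close>.\<close>

definition machine_bp :: "ntm \<Rightarrow> nat \<Rightarrow> nat \<Rightarrow> nat \<Rightarrow> bp" where
  "machine_bp M B S n =
     (let z = 2 * n + 2; K = radix B S n
      in sweep_bp z (width B S n) (ntm_start M + K * K) (\<lambda>u. u mod K = ntm_accept M)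
           (machine_step M K B z))"

lemma machine_bp_simps:
  "bp_inputs (machine_bp M B S n) = 2 * n + 2"
  "bp_length (machine_bp M B S n) = layers B S n + 1"
  "bp_width (machine_bp M B S n) = width B S n"
  "bp_label (machine_bp M B S n) = (\<lambda>i. i mod (2 * n + 2))"
  by (simp_all add: machine_bp_def sweep_bp_def layers_def Let_def)

lemma radix_bounds:
  assumes "0 < B"
  shows "2 * n + 2 + B \<le> radix B S n" "B ^ S \<le> radix B S n"
proof -
  have "1 \<le> B ^ S" using assms by simp
  then show "2 * n + 2 + B \<le> radix B S n"
    unfolding radix_def using mult_le_mono2[of 1 "B ^ S" "2 * n + 2 + B"] by simp
qed (simp add: radix_def)

lemma radix_le_width: "radix B S n \<le> width B S n"
  by (cases "radix B S n = 0") (auto simp: width_def intro: self_le_power)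

lemma width_pos: "0 < B \<Longrightarrow> 0 < width B S n"
  using radix_bounds(1)[of B n S] radix_le_width[of B S n] by linarith

lemma wf_machine_bp: "0 < B \<Longrightarrow> wf_bp (machine_bp M B S n)"
  unfolding machine_bp_def Let_def by (intro wf_sweep_bp width_pos) simp_all

lemma rtranclp_image:
  assumes "\<And>c v. r\<^sup>*\<^sup>* a c \<Longrightarrow> r' (f c) v \<longleftrightarrow> (\<exists>c'. r c c' \<and> v = f c')"
  shows "r'\<^sup>*\<^sup>* (f a) v \<longleftrightarrow> (\<exists>c. r\<^sup>*\<^sup>* a c \<and> v = f c)"
proof
  assume "r'\<^sup>*\<^sup>* (f a) v"
  then show "\<exists>c. r\<^sup>*\<^sup>* a c \<and> v = f c"
  proof (induction rule: rtranclp_induct)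
    case (step u v)
    then show ?case using assms by (meson rtranclp.rtrancl_into_rtrancl)
  qed auto
next
  assume "\<exists>c. r\<^sup>*\<^sup>* a c \<and> v = f c"
  then obtain c where "r\<^sup>*\<^sup>* a c" "v = f c" by blast
  then show "r'\<^sup>*\<^sup>* (f a) v"
  proof (induction arbitrary: v rule: rtranclp_induct)
    case (step b c)
    then show ?case using assms by (metis rtranclp.rtrancl_into_rtrancl)
  qed simp
qed

locale bounded_ntm =
  fixes M :: ntm and B S n :: nat and x :: "bool list"
  assumes delta_bound: "(q, s, g, q', g', d, d') \<in> ntm_delta M \<Longrightarrow> q' < B \<and> g' < B"
    and start_bound: "ntm_start M < B"
    and two_le_B: "2 \<le> B"
    and space: "ntm_reachable M x (q, i, h, w) \<Longrightarrow> h < S"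
    and length_x: "length x = 2 * n"
begin

abbreviation "K \<equiv> radix B S n"
abbreviation "z \<equiv> 2 * n + 2"
abbreviation "code \<equiv> conf_code K B S"
abbreviation "y \<equiv> False # x @ [False]"

lemma reachable_bounds:
  assumes "ntm_reachable M x (q, i, h, w)"
  shows "q < B" "i \<le> 2 * n + 1" "h < S" "w k < B"
proof -
  have "(\<lambda>(q, i, h, w). q < B \<and> i \<le> 2 * n + 1 \<and> (\<forall>k. w k < B)) c"
    if "(ntm_step M x)\<^sup>*\<^sup>* (ntm_init M) c" for c
    using that
  proof (induction rule: rtranclp_induct)
    case base
    then show ?case using start_bound two_le_B by (simp add: ntm_init_def)
  next
    case (step c c')
    from step(2) step(3) show ?case
      by (cases rule: ntm_step.cases) (use delta_bound length_x in auto)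
  qed
  from this[OF assms[unfolded ntm_reachable_def]] space[OF assms]
  show "q < B" "i \<le> 2 * n + 1" "h < S" "w k < B" by auto
qed

lemma reachable_digits:
  assumes "ntm_reachable M x (q, i, h, w)"
  shows "q < K" "i < K" "B ^ h < K" "tape_code B S w < K"
proof -
  note bounds = reachable_bounds[OF assms]
  have radix: "2 * n + 2 + B \<le> K" "B ^ S \<le> K" using radix_bounds two_le_B by simp_all
  show "q < K" "i < K" using bounds radix by simp_all
  have "B ^ h < B ^ S" using bounds two_le_B by (intro power_strict_increasing) auto
  then show "B ^ h < K" using radix by simp
  show "tape_code B S w < K" using less_le_trans[OF tape_code_less radix(2)] bounds by blast
qed

lemma reachable_code: "ntm_reachable M x c \<Longrightarrow> 0 < code c \<and> code c < width B S n"
proof (cases c)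
  case (fields q i h w)
  assume "ntm_reachable M x c"
  note digits = reachable_digits[OF this[unfolded fields]]
  have "0 < B ^ h" using two_le_B by simp
  moreover have "code c < K ^ 4" unfolding fields using digits by (rule conf_code_less)
  ultimately show ?thesis using digits(1) by (auto simp: fields width_def)
qed

lemma scanned_eq_input_at: "i < z \<Longrightarrow> scanned z i (y ! i) = input_at x i"
  by (auto simp: scanned_def input_at_def length_x nth_Cons' nth_append)

lemma trans_edge_code:
  assumes "ntm_reachable M x (q, i, h, w)" "j < z"
  shows "trans_edge K B z (q1, s, g, q', g', d, d') j (y ! j) (code (q, i, h, w)) v \<longleftrightarrow>
     q1 = q \<and> i = j \<and> s = input_at x i \<and> g = w h \<and>
     v = code (q', min (move d i) (length x + 1), move d' h, w(h := g'))"
proof -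
  note bounds = reachable_bounds[OF assms(1)] and digits = reachable_digits[OF assms(1)]
  note dec = conf_code_decode[OF digits(1-3), of S w]
  have "tape_code B S w div B ^ h mod B = w h" using bounds by (intro tape_code_digit) auto
  then show ?thesis
    unfolding trans_edge.simps Let_def dec
    using bounds assms(2) scanned_eq_input_at[of i] power_move[OF two_le_B]
    by (auto simp: tape_code_upd length_x)
qed

lemma machine_step_code:
  assumes "ntm_reachable M x c"
  shows "query_step z (machine_step M K B z) y (code c) v \<longleftrightarrow> (\<exists>c'. ntm_step M x c c' \<and> v = code c')"
proof -
  obtain q i h w where c: "c = (q, i, h, w)" by (cases c)
  note r = assms[unfolded c]
  show ?thesis
  proof
    assume "query_step z (machine_step M K B z) y (code c) v"
    then obtain j q1 s g q' g' d d' where "j < z" and tr: "(q1, s, g, q', g', d, d') \<in> ntm_delta M"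
      and "trans_edge K B z (q1, s, g, q', g', d, d') j (y ! j) (code c) v"
      unfolding query_step_def machine_step_def by (metis prod_cases7)
    then have "q1 = q" "s = input_at x i" "g = w h"
      and v: "v = code (q', min (move d i) (length x + 1), move d' h, w(h := g'))"
      unfolding c trans_edge_code[OF r \<open>j < z\<close>] by simp_all
    then have "ntm_step M x c (q', min (move d i) (length x + 1), move d' h, w(h := g'))"
      unfolding c using tr by (intro ntm_step.intros) simp
    then show "\<exists>c'. ntm_step M x c c' \<and> v = code c'" using v by blast
  next
    assume "\<exists>c'. ntm_step M x c c' \<and> v = code c'"
    then obtain q' g' d d' where tr: "(q, input_at x i, w h, q', g', d, d') \<in> ntm_delta M"
      and v: "v = code (q', min (move d i) (length x + 1), move d' h, w(h := g'))"
      unfolding c by (auto elim: ntm_step.cases simp del: conf_code.simps)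
    have i: "i < z" using reachable_bounds(2)[OF r] by simp
    then have "trans_edge K B z (q, input_at x i, w h, q', g', d, d') i (y ! i) (code c) v"
      unfolding c trans_edge_code[OF r i] using v by simp
    then show "query_step z (machine_step M K B z) y (code c) v"
      unfolding query_step_def machine_step_def using tr i by blast
  qed
qed

lemma machine_bp_accepts_iff: "bp_accepts (machine_bp M B S n) y \<longleftrightarrow> ntm_accepts M x"
proof -
  let ?step = "query_step z (machine_step M K B z) y"
  have init: "code (ntm_init M) = ntm_start M + K * K" by (simp add: ntm_init_def tape_code_def)
  have run: "?step\<^sup>*\<^sup>* (ntm_start M + K * K) u \<longleftrightarrow> (\<exists>c. ntm_reachable M x c \<and> u = code c)" for u
    unfolding init[symmetric] ntm_reachable_def
    by (rule rtranclp_image) (rule machine_step_code[unfolded ntm_reachable_def])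
  interpret sweep z "width B S n" "ntm_start M + K * K" "\<lambda>u. u mod K = ntm_accept M"
      "machine_step M K B z" y
  proof
    show "0 < u \<and> u < width B S n" if "?step\<^sup>*\<^sup>* (ntm_start M + K * K) u" for u
      using that reachable_code unfolding run by blast
  qed simp
  have "code c mod K = fst c" if "ntm_reachable M x c" for c
  proof (cases c)
    case (fields q i h w)
    then show ?thesis
      using reachable_digits[OF that[unfolded fields]] conf_code_decode(1)[of q K i B h S w] by simp
  qed
  then have "bp_accepts (machine_bp M B S n) y \<longleftrightarrow>
      (\<exists>c. ntm_reachable M x c \<and> fst c = ntm_accept M)"
    unfolding machine_bp_def Let_def sweep_bp_accepts_iff run by metis
  also have "\<dots> \<longleftrightarrow> ntm_accepts M x" unfolding ntm_accepts_def by force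
  finally show ?thesis .
qed

end

section \<open>The reduction program\<close>

abbreviation plus_exp (infixl \<open>\<oplus>\<close> 65) where "a \<oplus> b \<equiv> Bin Plus a b"
abbreviation minus_exp (infixl \<open>\<ominus>\<close> 65) where "a \<ominus> b \<equiv> Bin Minus a b"
abbreviation times_exp (infixl \<open>\<otimes>\<close> 70) where "a \<otimes> b \<equiv> Bin Times a b"
abbreviation div_exp (infixl \<open>\<oslash>\<close> 70) where "a \<oslash> b \<equiv> Bin Divide a b"

definition mod_exp :: "aexp \<Rightarrow> aexp \<Rightarrow> aexp" where
  "mod_exp a b = a \<ominus> (a \<oslash> b) \<otimes> b"

definition min_exp :: "aexp \<Rightarrow> aexp \<Rightarrow> aexp" where
  "min_exp a b = a \<ominus> (a \<ominus> b)"

definition max_exp :: "aexp \<Rightarrow> aexp \<Rightarrow> aexp" where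
  "max_exp a b = a \<oplus> (b \<ominus> a)"

definition pos_exp :: "aexp \<Rightarrow> aexp" where
  "pos_exp a = Num 1 \<ominus> (Num 1 \<ominus> a)"

definition less_exp :: "aexp \<Rightarrow> aexp \<Rightarrow> aexp" where
  "less_exp a b = pos_exp (b \<ominus> a)"

definition eq_exp :: "aexp \<Rightarrow> aexp \<Rightarrow> aexp" where
  "eq_exp a b = Num 1 \<ominus> ((a \<ominus> b) \<oplus> (b \<ominus> a))"

fun sum_exp :: "aexp list \<Rightarrow> aexp" where
  "sum_exp [] = Num 0"
| "sum_exp (e # es) = e \<oplus> sum_exp es"

fun power_exp :: "aexp \<Rightarrow> nat \<Rightarrow> aexp" where
  "power_exp e 0 = Num 1"
| "power_exp e (Suc k) = e \<otimes> power_exp e k"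

lemma eval_arith_exps [simp]:
  "eval (mod_exp a b) \<sigma> = eval a \<sigma> mod eval b \<sigma>"
  "eval (min_exp a b) \<sigma> = min (eval a \<sigma>) (eval b \<sigma>)"
  "eval (max_exp a b) \<sigma> = max (eval a \<sigma>) (eval b \<sigma>)"
  "eval (pos_exp a) \<sigma> = of_bool (0 < eval a \<sigma>)"
  "eval (less_exp a b) \<sigma> = of_bool (eval a \<sigma> < eval b \<sigma>)"
  "eval (eq_exp a b) \<sigma> = of_bool (eval a \<sigma> = eval b \<sigma>)"
  by (auto simp: mod_exp_def min_exp_def max_exp_def pos_exp_def less_exp_def eq_exp_def
    minus_div_mult_eq_mod)

lemma eval_power_exp [simp]: "eval (power_exp a k) \<sigma> = eval a \<sigma> ^ k"
  by (induction k) simp_all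

lemma eval_sum_exp_pos: "0 < eval (sum_exp es) \<sigma> \<longleftrightarrow> (\<exists>e\<in>set es. 0 < eval e \<sigma>)"
  by (induction es) auto

fun scanned_exp :: "aexp \<Rightarrow> insym \<Rightarrow> aexp \<Rightarrow> bool \<Rightarrow> aexp" where
  "scanned_exp z LeftEnd j m = eq_exp j (Num 0)"
| "scanned_exp z (Bit b) j m = pos_exp j \<otimes> less_exp j (z \<ominus> Num 1) \<otimes> Num (of_bool (b = m))"
| "scanned_exp z RightEnd j m = pos_exp j \<otimes> (Num 1 \<ominus> less_exp j (z \<ominus> Num 1))"

fun move_exp :: "dir \<Rightarrow> aexp \<Rightarrow> aexp" where
  "move_exp MoveL i = i \<ominus> Num 1"
| "move_exp Stay i = i"
| "move_exp MoveR i = i \<oplus> Num 1"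

fun power_move_exp :: "aexp \<Rightarrow> dir \<Rightarrow> aexp \<Rightarrow> aexp" where
  "power_move_exp G MoveL P = max_exp (P \<oslash> G) (Num 1)"
| "power_move_exp G Stay P = P"
| "power_move_exp G MoveR P = P \<otimes> G"

fun trans_exp :: "aexp \<Rightarrow> aexp \<Rightarrow> aexp \<Rightarrow> transition \<Rightarrow> aexp \<Rightarrow> bool \<Rightarrow> aexp \<Rightarrow> aexp \<Rightarrow> aexp" where
  "trans_exp K G z (q, s, g, q', g', d, d') j m u v =
     (let i = mod_exp (u \<oslash> K) K; P = mod_exp (u \<oslash> K \<oslash> K) K; w = u \<oslash> K \<oslash> K \<oslash> K
      in eq_exp (mod_exp u K) (Num q) \<otimes> eq_exp i j \<otimes> scanned_exp z s j m \<otimes>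
         eq_exp (mod_exp (w \<oslash> P) G) (Num g) \<otimes>
         eq_exp v (Num q' \<oplus> K \<otimes> (min_exp (move_exp d i) (z \<ominus> Num 1) \<oplus>
           K \<otimes> (power_move_exp G d' P \<oplus> K \<otimes> (w \<oplus> Num g' \<otimes> P \<ominus> Num g \<otimes> P)))))"

definition edge_exp ::
    "ntm \<Rightarrow> transition list \<Rightarrow> aexp \<Rightarrow> aexp \<Rightarrow> aexp \<Rightarrow> aexp \<Rightarrow> aexp \<Rightarrow> aexp \<Rightarrow> bool \<Rightarrow> aexp" where
  "edge_exp M trs K G z i u v m = pos_exp (
     eq_exp i (Num 0) \<otimes> (eq_exp u (Num 0) \<otimes> eq_exp v (Num (ntm_start M) \<oplus> K \<otimes> K)) \<oplus>
     pos_exp i \<otimes> (eq_exp u v \<oplus> eq_exp v (Num 0) \<otimes> eq_exp (mod_exp u K) (Num (ntm_accept M)) \<oplus>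
       sum_exp (map (\<lambda>tr. trans_exp K G z tr (mod_exp i z) m u v) trs)))"

lemma eval_scanned_exp [simp]:
  "eval (scanned_exp z s j m) \<sigma> = of_bool (s = scanned (eval z \<sigma>) (eval j \<sigma>) m)"
  by (cases s) (auto simp: scanned_def)

lemma eval_move_exps [simp]:
  "eval (move_exp d i) \<sigma> = move d (eval i \<sigma>)"
  "eval (power_move_exp G d P) \<sigma> = power_move (eval G \<sigma>) d (eval P \<sigma>)"
  by (cases d; simp)+

lemma eval_trans_exp:
  "eval (trans_exp K G z tr j m u v) \<sigma> =
     of_bool (trans_edge (eval K \<sigma>) (eval G \<sigma>) (eval z \<sigma>) tr (eval j \<sigma>) m (eval u \<sigma>) (eval v \<sigma>))"
  by (cases tr) (simp add: Let_def flip: of_bool_conj)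

lemma eval_edge_exp:
  assumes "set trs = ntm_delta M"
  shows "eval (edge_exp M trs K G z i u v m) \<sigma> =
     of_bool (sweep_edge (eval z \<sigma>) (ntm_start M + eval K \<sigma> * eval K \<sigma>)
       (\<lambda>u. u mod eval K \<sigma> = ntm_accept M) (machine_step M (eval K \<sigma>) (eval G \<sigma>) (eval z \<sigma>))
       (eval i \<sigma>) (eval u \<sigma>) (eval v \<sigma>) m)"
  by (auto simp: edge_exp_def sweep_edge_def machine_step_def eval_trans_exp eval_sum_exp_pos assms)

definition log_cmd :: "nat \<Rightarrow> nat \<Rightarrow> cmd" where
  "log_cmd l r = Assign l (Num 0) ;;
     Repeat (Var r) (Assign l (Var l \<oplus> pos_exp (Var r)) ;; Assign r (Var r \<oslash> Num 2))"

lemma floorlog_half: "floorlog 2 m = floorlog 2 (m div 2) + of_bool (0 < m)"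
  by (subst compute_floorlog) (simp add: floorlog_def)

lemma hoare_log_cmd:
  assumes vars: "l \<noteq> r" "l \<notin> fst ` set vs" "r \<notin> fst ` set vs" and bound: "m \<le> X"
  shows "hoare X (state_at ((r, m) # vs) inp out) (log_cmd l r) (3 * m + 2)
           (state_at ((l, floorlog 2 m) # vs) inp out)"
proof -
  let ?I = "\<lambda>t. state_at ((r, m div 2 ^ t) # (l, floorlog 2 m - floorlog 2 (m div 2 ^ t))
    # vs) inp out"
  have init: "hoare X (state_at ((r, m) # vs) inp out) (Assign l (Num 0)) 1 (?I 0)"
    using vars by (auto simp: hoare_def state_at_def)
  have log_le: "floorlog 2 m \<le> X" using floorlog_leI[of m 2 m] bound by simp
  have loop: "hoare X (?I 0)
     (Repeat (Var r) (Assign l (Var l \<oplus> pos_exp (Var r)) ;; Assign r (Var r \<oslash> Num 2)))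
       (m * (2 + 1) + 1) (?I m)"
  proof (rule hoare_Repeat[where I = ?I])
    fix t
    have half: "m div 2 ^ Suc t = m div 2 ^ t div 2"
      by (simp only: power_Suc2 div_mult2_eq)
    have "floorlog 2 (m div 2 ^ t) \<le> floorlog 2 m" by (intro floorlog_mono) simp
    then have "floorlog 2 m - floorlog 2 (m div 2 ^ Suc t) =
        floorlog 2 m - floorlog 2 (m div 2 ^ t) + of_bool (0 < m div 2 ^ t)"
      unfolding half using floorlog_half[of "m div 2 ^ t"] by simp
    moreover have "m div 2 ^ t div 2 \<le> X" using bound by (meson div_le_dividend le_trans)
    ultimately show "hoare X (?I t)
        (Assign l (Var l \<oplus> pos_exp (Var r)) ;; Assign r (Var r \<oslash> Num 2)) 2 (?I (Suc t))"
      unfolding half using vars log_le by (auto simp: hoare_def state_at_def)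
  qed (auto simp: state_at_def)
  have "m div 2 ^ m = 0" by simp
  then show ?thesis
    unfolding log_cmd_def
    by (intro hoare_weaken[OF hoare_Seq[OF init loop]]) (auto simp: state_at_def floorlog_def)
qed

definition power_cmd :: "nat \<Rightarrow> nat \<Rightarrow> aexp \<Rightarrow> cmd" where
  "power_cmd p b e = Assign p (Num 1) ;; Repeat e (Assign p (Var p \<otimes> Num b))"

lemma hoare_power_cmd:
  assumes count: "\<And>\<sigma>. binds \<sigma> ((p, 1) # vs) \<Longrightarrow> eval e \<sigma> = m"
    and fresh: "p \<notin> fst ` set vs" and base: "0 < b" "b ^ m \<le> X"
  shows "hoare X (state_at vs inp out) (power_cmd p b e) (2 * m + 2)
    (state_at ((p, b ^ m) # vs) inp out)"
proof -
  let ?I = "\<lambda>t. state_at ((p, b ^ t) # vs) inp out"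
  have power_le: "b ^ t \<le> X" if "t \<le> m" for t
    using power_increasing[of t m b] that base by simp
  have init: "hoare X (state_at vs inp out) (Assign p (Num 1)) 1 (?I 0)"
    using fresh power_le[of 0] by (auto simp: hoare_def state_at_def)
  have loop: "hoare X (?I 0) (Repeat e (Assign p (Var p \<otimes> Num b))) (m * (1 + 1) + 1) (?I m)"
  proof (rule hoare_Repeat[where I = ?I])
    fix t assume "t < m"
    then show "hoare X (?I t) (Assign p (Var p \<otimes> Num b)) 1 (?I (Suc t))"
      using fresh power_le[of "Suc t"] by (auto simp: hoare_def state_at_def mult.commute)
  qed (use count in \<open>auto simp: state_at_def\<close>)
  show ?thesis
    unfolding power_cmd_def by (intro hoare_weaken[OF hoare_Seq[OF init loop]]) simp_all
qed

abbreviation (input) "count_var \<equiv> 0 :: nat"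
abbreviation (input) "length_var \<equiv> 1 :: nat"
abbreviation (input) "inputs_var \<equiv> 2 :: nat"
abbreviation (input) "log_var \<equiv> 3 :: nat"
abbreviation (input) "half_var \<equiv> 4 :: nat"
abbreviation (input) "space_var \<equiv> 5 :: nat"
abbreviation (input) "power_var \<equiv> 6 :: nat"
abbreviation (input) "radix_var \<equiv> 7 :: nat"
abbreviation (input) "width_var \<equiv> 8 :: nat"
abbreviation (input) "layers_var \<equiv> 9 :: nat"
abbreviation (input) "layer_var \<equiv> 10 :: nat"
abbreviation (input) "source_var \<equiv> 11 :: nat"
abbreviation (input) "target_var \<equiv> 12 :: nat"
abbreviation (input) "bit_var \<equiv> 13 :: nat"

definition space_bound :: "nat \<Rightarrow> nat \<Rightarrow> nat \<Rightarrow> nat" where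
  "space_bound c k n = c * floorlog 2 (2 * n) ^ k + c"

definition params_cmd :: "nat \<Rightarrow> nat \<Rightarrow> nat \<Rightarrow> cmd" where
  "params_cmd B c k =
     (Input count_var ;; Input length_var ;;
      Assign inputs_var (Num 2 \<otimes> Var length_var \<oplus> Num 2) ;;
      Assign half_var (Num 2 \<otimes> Var length_var)) ;;
     log_cmd log_var half_var ;;
     Assign space_var (Num c \<otimes> power_exp (Var log_var) k \<oplus> Num c) ;;
     power_cmd power_var B (Var space_var) ;;
     (Assign radix_var ((Var inputs_var \<oplus> Num B) \<otimes> Var power_var) ;;
      Assign width_var (power_exp (Var radix_var) 4) ;;
      Assign layers_var (Num 2 \<oplus> Var inputs_var \<otimes> power_exp (Var width_var) 2))"

definition env :: "nat \<Rightarrow> nat \<Rightarrow> nat \<Rightarrow> nat \<Rightarrow> (nat \<times> nat) list" where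
  "env B S N n =
     [(count_var, N), (length_var, n), (inputs_var, 2 * n + 2), (radix_var, radix B S n),
      (width_var, width B S n), (layers_var, layers B S n)]"

lemma le_layers:
  assumes "2 \<le> B"
  shows "width B S n \<le> layers B S n" "radix B S n \<le> layers B S n" "B ^ S \<le> layers B S n"
    "S \<le> layers B S n" "4 * n + 4 \<le> layers B S n"
proof -
  let ?W = "width B S n"
  have radix: "2 * n + 2 + B \<le> radix B S n" "B ^ S \<le> radix B S n" "radix B S n \<le> ?W"
    using radix_bounds radix_le_width assms by simp_all
  then have W_ge: "2 \<le> ?W" by linarith
  have layers: "layers B S n = 2 + (2 * n + 2) * ?W ^ 2" by (simp add: layers_def sweep_layers_def)
  have "?W * 1 \<le> ?W * ?W" using W_ge by (intro mult_le_mono2) simp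
  also have "\<dots> \<le> (2 * n + 2) * ?W ^ 2" by (simp add: power2_eq_square)
  finally show W_le: "?W \<le> layers B S n" unfolding layers by simp
  have "2 * 1 \<le> ?W * ?W" using W_ge by (intro mult_le_mono) simp_all
  then have "(2 * n + 2) * 2 \<le> (2 * n + 2) * ?W ^ 2"
    by (intro mult_le_mono2) (simp add: power2_eq_square)
  then show "4 * n + 4 \<le> layers B S n" unfolding layers by simp
  show "radix B S n \<le> layers B S n" "B ^ S \<le> layers B S n" using radix W_le by linarith+
  moreover have "S < 2 ^ S" by simp
  moreover have "(2::nat) ^ S \<le> B ^ S" using assms by (rule power_mono) simp
  ultimately show "S \<le> layers B S n" by linarith
qed

lemma hoare_params_cmd:
  assumes base: "2 \<le> B" and space_eq: "S = space_bound c k n" and bounds: "N \<le> X" "layers B S n \<le> X"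
  shows "hoare X (\<lambda>s. s = (\<lambda>_. 0, N # n # rest, [])) (params_cmd B c k)
           (6 * n + 2 * S + 12) (state_at (env B S N n) rest [])"
proof -
  note le_X = le_layers[OF base, THEN le_trans, OF bounds(2)]
  let ?vs = "[(count_var, N), (length_var, n), (inputs_var, 2 * n + 2)]"
  let ?s = "\<lambda>vs. state_at (vs @ ?vs) rest []"
  have read: "hoare X (\<lambda>s. s = (\<lambda>_. 0, N # n # rest, []))
      (Input count_var ;; Input length_var ;;
       Assign inputs_var (Num 2 \<otimes> Var length_var \<oplus> Num 2) ;;
       Assign half_var (Num 2 \<otimes> Var length_var)) 4 (?s [(half_var, 2 * n)])"
    using bounds(1) le_X(5) by (auto simp: hoare_def state_at_def)
  have log: "hoare X (?s [(half_var, 2 * n)]) (log_cmd log_var half_var) (3 * (2 * n) + 2)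
      (?s [(log_var, floorlog 2 (2 * n))])"
    using hoare_log_cmd[of log_var half_var ?vs "2 * n"] le_X(5) by simp
  have space: "hoare X (?s [(log_var, floorlog 2 (2 * n))])
      (Assign space_var (Num c \<otimes> power_exp (Var log_var) k \<oplus> Num c)) 1 (?s [(space_var, S)])"
    using le_X(4) by (auto simp: hoare_def state_at_def space_eq space_bound_def)
  have power: "hoare X (?s [(space_var, S)]) (power_cmd power_var B (Var space_var)) (2 * S + 2)
      (?s [(power_var, B ^ S), (space_var, S)])"
    using hoare_power_cmd[of power_var "(space_var, S) # ?vs" "Var space_var" S B]
      base le_X(3) by simp
  have dimensions: "hoare X (?s [(power_var, B ^ S), (space_var, S)])
      (Assign radix_var ((Var inputs_var \<oplus> Num B) \<otimes> Var power_var) ;;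
       Assign width_var (power_exp (Var radix_var) 4) ;;
       Assign layers_var (Num 2 \<oplus> Var inputs_var \<otimes> power_exp (Var width_var) 2)) 3
      (state_at (env B S N n) rest [])"
    using le_X(1,2) bounds(2)
    by (auto simp: hoare_def state_at_def env_def radix_def width_def layers_def sweep_layers_def
      simp del: mult_Suc)
  show ?thesis
    unfolding params_cmd_def
    by (rule hoare_weaken[OF hoare_Seq[OF read hoare_Seq[OF log hoare_Seq[OF space
      hoare_Seq[OF power dimensions]]]]]) simp_all
qed

definition labels_cmd :: cmd where
  "labels_cmd = For layer_var (Var layers_var) (Output (mod_exp (Var layer_var) (Var inputs_var)))"

definition edge_cmd :: "ntm \<Rightarrow> nat \<Rightarrow> transition list \<Rightarrow> bool \<Rightarrow> cmd" where
  "edge_cmd M B trs m = Output (edge_exp M trs (Var radix_var) (Num B) (Var inputs_var)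
     (Var layer_var) (Var source_var) (Var target_var) m)"

definition matrices_cmd :: "ntm \<Rightarrow> nat \<Rightarrow> transition list \<Rightarrow> cmd" where
  "matrices_cmd M B trs =
     For layer_var (Var layers_var) (For source_var (Var width_var) (For target_var (Var width_var)
       (edge_cmd M B trs False ;; edge_cmd M B trs True)))"

definition bp_cmd :: "ntm \<Rightarrow> nat \<Rightarrow> transition list \<Rightarrow> cmd" where
  "bp_cmd M B trs =
     (Output (Var inputs_var) ;; Output (Var layers_var \<oplus> Num 1) ;; Output (Var width_var)) ;;
     labels_cmd ;; matrices_cmd M B trs"

lemma hoare_labels_cmd:
  assumes "layers B S n \<le> X"
  shows "hoare X (state_at (env B S N n) inp out) labels_cmd (layers B S n * 3 + 2)
     (state_at (env B S N n) inp (out @ map (bp_label (machine_bp M B S n)) [0..<layers B S n]))"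
proof -
  have "hoare X (state_at (env B S N n) inp out) labels_cmd (layers B S n * (1 + 2) + 2)
     (state_at (env B S N n) inp (out @ concat (map (\<lambda>i. [i mod (2 * n + 2)]) [0..<layers B S n])))"
    unfolding labels_cmd_def
  proof (rule hoare_For)
    fix i out
    show "hoare X (state_at ((layer_var, i) # env B S N n) inp out)
      (Output (mod_exp (Var layer_var) (Var inputs_var))) 1
      (state_at ((layer_var, i) # env B S N n) inp (out @ [i mod (2 * n + 2)]))"
      by (auto simp: hoare_def state_at_def env_def)
  qed (use assms in \<open>auto simp: env_def\<close>)
  then show ?thesis
    by (rule hoare_weaken) (simp_all add: machine_bp_simps concat_map_singleton)
qed

lemma hoare_edge_cmd:
  assumes "set trs = ntm_delta M" "i < layers B S n" "u < width B S n" "v < width B S n"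
    and "vs = (target_var, v) # (source_var, u) # (layer_var, i) # env B S N n"
  shows "hoare X (state_at vs inp out) (edge_cmd M B trs m) 1
    (state_at vs inp (out @ [of_bool ((i, u, v, m) \<in> bp_edges (machine_bp M B S n))]))"
  using assms(2-) unfolding edge_cmd_def
  by (auto simp: hoare_def state_at_def env_def eval_edge_exp[OF assms(1)] machine_bp_def Let_def
    sweep_bp_def layers_def)

lemma hoare_matrices_cmd:
  assumes trs: "set trs = ntm_delta M" and bounds: "layers B S n \<le> X" "width B S n \<le> X"
  defines "E \<equiv> layers B S n" and "W \<equiv> width B S n" and "P \<equiv> machine_bp M B S n"
  shows "hoare X (state_at (env B S N n) inp out) (matrices_cmd M B trs)
     (E * (W * (4 * W + 4) + 4) + 2)
     (state_at (env B S N n) inp (out @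
       [of_bool ((i, u, v, m) \<in> bp_edges P).
          i \<leftarrow> [0..<E], u \<leftarrow> [0..<W], v \<leftarrow> [0..<W], m \<leftarrow> [False, True]]))"
proof -
  let ?layer = "\<lambda>i. (layer_var, i) # env B S N n"
  let ?row = "\<lambda>i u. (source_var, u) # ?layer i"
  let ?edges = "edge_cmd M B trs False ;; edge_cmd M B trs True"
  let ?bits = "\<lambda>i u v. [of_bool ((i, u, v, m) \<in> bp_edges P). m \<leftarrow> [False, True]] :: nat list"
  have env: "\<sigma> layers_var = E" "\<sigma> width_var = W" if "binds \<sigma> (env B S N n)" for \<sigma>
    using that by (simp_all add: env_def E_def W_def)
  have fresh: "x \<notin> fst ` set (env B S N n)" if "10 \<le> x" for x
    using that by (auto simp: env_def)
  have entry: "hoare X (state_at ((target_var, v) # ?row i u) inp out) ?edges (1 + 1)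
      (state_at ((target_var, v) # ?row i u) inp (out @ ?bits i u v))"
    if "i < E" "u < W" "v < W" for i u v out
    using hoare_Seq[OF hoare_edge_cmd[OF trs _ _ _ HOL.refl] hoare_edge_cmd[OF trs _ _ _ HOL.refl]]
      that
    by (simp add: E_def W_def P_def)
  have row: "hoare X (state_at (?row i u) inp out) (For target_var (Var width_var) ?edges)
      (W * (1 + 1 + 2) + 2) (state_at (?row i u) inp (out @ concat (map (?bits i u) [0..<W])))"
    if "i < E" "u < W" for i u out
    by (rule hoare_For) (use that bounds env fresh entry W_def in auto)
  have matrix: "hoare X (state_at (?layer i) inp out)
      (For source_var (Var width_var) (For target_var (Var width_var) ?edges))
      (W * (W * (1 + 1 + 2) + 2 + 2) + 2)
      (state_at (?layer i) inp (out @ concat (map (\<lambda>u. concat (map (?bits i u) [0..<W])) [0..<W])))"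
    if "i < E" for i out
    by (rule hoare_For) (use that bounds env fresh row W_def in auto)
  have "hoare X (state_at (env B S N n) inp out) (matrices_cmd M B trs)
      (E * (W * (W * (1 + 1 + 2) + 2 + 2) + 2 + 2) + 2)
      (state_at (env B S N n) inp (out @
        concat (map (\<lambda>i. concat (map (\<lambda>u. concat (map (?bits i u) [0..<W])) [0..<W])) [0..<E])))"
    unfolding matrices_cmd_def by (rule hoare_For) (use bounds env fresh matrix E_def in auto)
  then show ?thesis by (rule hoare_weaken) (simp_all add: algebra_simps)
qed

lemma hoare_bp_cmd:
  assumes base: "2 \<le> B" and trs: "set trs = ntm_delta M" and bound: "layers B S n \<le> X"
  defines "E \<equiv> layers B S n" and "W \<equiv> width B S n"
  shows "hoare X (state_at (env B S N n) inp []) (bp_cmd M B trs)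
           (E * (W * (4 * W + 4) + 4) + 3 * E + 7)
           (state_at (env B S N n) inp (bp_code (machine_bp M B S n)))"
proof -
  let ?P = "machine_bp M B S n"
  have header: "hoare X (state_at (env B S N n) inp [])
      (Output (Var inputs_var) ;; Output (Var layers_var \<oplus> Num 1) ;; Output (Var width_var)) 3
      (state_at (env B S N n) inp [bp_inputs ?P, bp_length ?P, bp_width ?P])"
    by (auto simp: hoare_def state_at_def env_def machine_bp_simps)
  have W_le: "width B S n \<le> X" using le_layers(1)[OF base] bound le_trans by blast
  show ?thesis
    unfolding bp_cmd_def
    using hoare_Seq[OF header hoare_Seq[OF hoare_labels_cmd[OF bound]
      hoare_matrices_cmd[OF trs bound W_le]]]
    by (rule hoare_weaken) (simp_all add: bp_code_def machine_bp_simps E_def W_def)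
qed

definition pad_left :: "bool list \<Rightarrow> bool list" where
  "pad_left a = False # a"

definition pad_right :: "bool list \<Rightarrow> bool list" where
  "pad_right b = b @ [False]"

lemma length_pad [simp]:
  "length (pad_left a) = length a + 1" "length (pad_right b) = length b + 1"
  by (simp_all add: pad_left_def pad_right_def)

abbreviation sets_code :: "nat \<Rightarrow> nat \<Rightarrow> bool list list \<Rightarrow> bool list list \<Rightarrow> nat list" where
  "sets_code N n as bs \<equiv> [N, n] @ bits as @ bits bs"

definition copy_row_cmd :: cmd where
  "copy_row_cmd = Repeat (Var length_var) (Input bit_var ;; Output (Var bit_var))"

definition copy_cmd :: cmd where
  "copy_cmd =
     (Output (Var count_var) ;; Output (Var length_var \<oplus> Num 1)) ;;
     Repeat (Var count_var) (Output (Num 0) ;; copy_row_cmd) ;;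
     Repeat (Var count_var) (copy_row_cmd ;; Output (Num 0))"

lemma hoare_copy_row_cmd:
  assumes "length a = n" "1 \<le> X"
  shows "hoare X (state_at (env B S N n) (map of_bool a @ rest) out) copy_row_cmd (3 * n + 1)
           (state_at (env B S N n) rest (out @ map of_bool a))"
proof -
  let ?g = "\<lambda>b. [of_bool b] :: nat list"
  have "hoare X (state_at (env B S N n) (concat (map ?g a) @ rest) out) copy_row_cmd
      (length a * (2 + 1) + 1) (state_at (env B S N n) rest (out @ concat (map ?g a)))"
    unfolding copy_row_cmd_def
    by (rule hoare_Repeat_list) (use assms in \<open>auto simp: hoare_def state_at_def env_def\<close>)
  then show ?thesis using assms(1) by (simp add: concat_map_singleton mult.commute)
qed

lemma hoare_Repeat_rows:
  assumes "length as = N"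
    and "\<And>a rest out. a \<in> set as \<Longrightarrow> hoare X (state_at (env B S N n) (map of_bool a @ rest) out) c k
      (state_at (env B S N n) rest (out @ map of_bool (f a)))"
  shows "hoare X (state_at (env B S N n) (bits as @ rest) out) (Repeat (Var count_var) c)
      (N * (k + 1) + 1) (state_at (env B S N n) rest (out @ bits (map f as)))"
proof -
  have "hoare X (state_at (env B S N n) (concat (map (map of_bool) as) @ rest) out)
      (Repeat (Var count_var) c) (length as * (k + 1) + 1)
      (state_at (env B S N n) rest (out @ concat (map (\<lambda>a. map of_bool (f a)) as)))"
    by (rule hoare_Repeat_list) (use assms in \<open>auto simp: env_def\<close>)
  then show ?thesis using assms(1) by (simp add: bits_def map_concat comp_def)
qed

lemma hoare_copy_cmd:
  assumes "length as = N" "length bs = N" "\<forall>a\<in>set as. length a = n" "\<forall>b\<in>set bs. length b = n"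
    and "1 \<le> X"
  shows "hoare X (state_at (env B S N n) (bits as @ bits bs) out) copy_cmd (2 * N * (3 * n + 3) + 4)
           (state_at (env B S N n) []
              (out @ sets_code N (n + 1) (map pad_left as) (map pad_right bs)))"
proof -
  let ?s = "state_at (env B S N n)"
  have put: "hoare X (?s inp out) (Output (Num 0)) 1 (?s inp (out @ [0]))" for inp out
    by (auto simp: hoare_def state_at_def)
  have header: "hoare X (?s (bits as @ bits bs) out)
      (Output (Var count_var) ;; Output (Var length_var \<oplus> Num 1)) 2
      (?s (bits as @ bits bs) (out @ [N, n + 1]))"
    by (auto simp: hoare_def state_at_def env_def)
  have row_a: "hoare X (?s (map of_bool a @ rest) out) (Output (Num 0) ;; copy_row_cmd)
    (1 + (3 * n + 1))
      (?s rest (out @ map of_bool (pad_left a)))" if "a \<in> set as" for a rest out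
    using hoare_Seq[OF put hoare_copy_row_cmd[of a n X]] that assms by (simp add: pad_left_def)
  have row_b: "hoare X (?s (map of_bool b @ rest) out) (copy_row_cmd ;; Output (Num 0))
    (3 * n + 1 + 1)
      (?s rest (out @ map of_bool (pad_right b)))" if "b \<in> set bs" for b rest out
    using hoare_Seq[OF hoare_copy_row_cmd[of b n X] put] that assms by (simp add: pad_right_def)
  note rows_a = hoare_Repeat_rows[OF assms(1) row_a]
    and rows_b = hoare_Repeat_rows[OF assms(2) row_b]
  show ?thesis
    unfolding copy_cmd_def
    using hoare_Seq[OF header hoare_Seq[OF rows_a rows_b[where rest = "[]", unfolded append_Nil2]]]
    by (rule hoare_weaken) (simp_all add: algebra_simps)
qed

definition reduction_cmd :: "ntm \<Rightarrow> nat \<Rightarrow> nat \<Rightarrow> nat \<Rightarrow> transition list \<Rightarrow> cmd" where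
  "reduction_cmd M B c k trs = params_cmd B c k ;; bp_cmd M B trs ;; copy_cmd"

lemma reduction_steps_le:
  fixes E W S n N :: nat
  assumes "W \<le> E" "S \<le> E" "n \<le> E" "1 \<le> E"
  shows "(6 * n + 2 * S + 12) + ((E * (W * (4 * W + 4) + 4) + 3 * E + 7) +
    (2 * N * (3 * n + 3) + 4))
    \<le> 50 * (N + 1) * E ^ 3"
proof -
  have pow: "E \<le> E ^ 3" "E ^ 2 \<le> E ^ 3" "1 \<le> E ^ 3"
    using assms(4) by (auto intro: self_le_power power_increasing)
  have "E * (W * (4 * W + 4) + 4) \<le> E * (E * (4 * E + 4) + 4)"
    using assms(1) by (intro mult_le_mono add_le_mono) auto
  also have "\<dots> = 4 * E ^ 3 + 4 * E ^ 2 + 4 * E" by (simp add: numeral_eq_Suc algebra_simps)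
  finally have "E * (W * (4 * W + 4) + 4) \<le> 12 * E ^ 3" using pow by linarith
  moreover have "2 * N * (3 * n + 3) \<le> 2 * N * (6 * E ^ 3)"
    using assms(3) pow by (intro mult_le_mono2) linarith
  ultimately have "(6 * n + 2 * S + 12) +
      ((E * (W * (4 * W + 4) + 4) + 3 * E + 7) + (2 * N * (3 * n + 3) + 4))
        \<le> 50 * E ^ 3 + 12 * (N * E ^ 3)"
    using assms(2,3) pow by linarith
  also have "\<dots> \<le> 50 * (N + 1) * E ^ 3" by (simp add: algebra_simps)
  finally show ?thesis .
qed

lemma reduction_cmd_computes:
  assumes base: "2 \<le> B" and trs: "set trs = ntm_delta M"
    and lists: "length as = N" "length bs = N" "\<forall>a\<in>set as. length a = n" "\<forall>b\<in>set bs. length b = n"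
    and space: "S = space_bound c k n" and size: "Z = csize (reduction_cmd M B c k trs)"
  shows "\<exists>t. ram_computes (compile (reduction_cmd M B c k trs) 0 Z) (sets_code N n as bs)
           (bp_code (machine_bp M B S n) @
              sets_code N (n + 1) (map pad_left as) (map pad_right bs)) t \<and>
           t \<le> 50 * (N + 1) * layers B S n ^ 3 * (2 * Z + 4) *
             (5 * len ((N + layers B S n + 2 * Z + 2) ^ Z))"
proof -
  let ?E = "layers B S n" and ?C = "reduction_cmd M B c k trs"
  let ?X = "N + ?E + 2 * Z + 2"
  have bounds: "N \<le> ?X" "?E \<le> ?X" "1 \<le> ?X" by simp_all
  have "?E * (width B S n * (4 * width B S n + 4) + 4) + 3 * ?E + 7 + (2 * N * (3 * n + 3) + 4) +
      (6 * n + 2 * S + 12) \<le> 50 * (N + 1) * ?E ^ 3"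
    using reduction_steps_le[of "width B S n" ?E S n N]
      le_layers[OF base, where S = S and n = n] by simp
  then have "hoare ?X (\<lambda>s. s = (\<lambda>_. 0, sets_code N n as bs, [])) ?C (50 * (N + 1) * ?E ^ 3)
     (\<lambda>s. snd (snd s) = bp_code (machine_bp M B S n) @
        sets_code N (n + 1) (map pad_left as) (map pad_right bs))"
    unfolding reduction_cmd_def
    by (intro hoare_weaken[OF hoare_Seq[OF hoare_params_cmd[OF base space bounds(1,2)]
       hoare_Seq[OF hoare_bp_cmd[OF base trs bounds(2)] hoare_copy_cmd[OF lists bounds(3)]]]])
      (auto simp: state_at_def)
  from hoare_ram_computes[OF this size] show ?thesis by simp
qed

section \<open>Growth rates\<close>

lemma ex_vanishing_exponent_iff:
  fixes g b :: "'a \<Rightarrow> real"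
  assumes base: "\<forall>\<^sub>F N in F. 1 < b N"
  shows "(\<exists>\<epsilon>. (\<epsilon> \<longlongrightarrow> 0) F \<and> (\<forall>\<^sub>F N in F. g N \<le> b N powr \<epsilon> N)) \<longleftrightarrow>
    (\<forall>\<delta>>0. \<forall>\<^sub>F N in F. g N \<le> b N powr \<delta>)"
proof (intro iffI allI impI)
  fix \<delta> :: real
  assume "\<exists>\<epsilon>. (\<epsilon> \<longlongrightarrow> 0) F \<and> (\<forall>\<^sub>F N in F. g N \<le> b N powr \<epsilon> N)" and "0 < \<delta>"
  then obtain \<epsilon> where "\<forall>\<^sub>F N in F. \<epsilon> N < \<delta>" "\<forall>\<^sub>F N in F. g N \<le> b N powr \<epsilon> N"
    using order_tendstoD(2) by blast
  with base show "\<forall>\<^sub>F N in F. g N \<le> b N powr \<delta>"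
  proof eventually_elim
    case (elim N)
    then have "b N powr \<epsilon> N \<le> b N powr \<delta>" by (intro powr_mono) auto
    then show ?case using elim by linarith
  qed
next
  assume small: "\<forall>\<delta>>0. \<forall>\<^sub>F N in F. g N \<le> b N powr \<delta>"
  define \<epsilon> where "\<epsilon> N = (if g N \<le> 1 then 0 else log (b N) (g N))" for N
  have "\<forall>\<^sub>F N in F. dist (\<epsilon> N) 0 < e" if e_pos: "0 < e" for e
    using small[rule_format, OF half_gt_zero[OF e_pos]] base
  proof eventually_elim
    case (elim N)
    show ?case
    proof (cases "g N \<le> 1")
      case False
      have "log (b N) (g N) \<le> e / 2" using elim False by (subst log_le_iff) auto
      moreover have "0 \<le> log (b N) (g N)" using elim False by simp
      ultimately show ?thesis using e_pos False by (simp add: \<epsilon>_def)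
    qed (simp add: \<epsilon>_def e_pos)
  qed
  then have "(\<epsilon> \<longlongrightarrow> 0) F" by (rule tendstoI)
  moreover have "\<forall>\<^sub>F N in F. g N \<le> b N powr \<epsilon> N"
    using base by eventually_elim (simp add: \<epsilon>_def)
  ultimately show "\<exists>\<epsilon>. (\<epsilon> \<longlongrightarrow> 0) F \<and> (\<forall>\<^sub>F N in F. g N \<le> b N powr \<epsilon> N)" by blast
qed

lemma le_two_powr_iff:
  fixes a x :: real
  assumes "0 \<le> x"
  shows "a \<le> 2 powr x \<longleftrightarrow> log 2 (max 1 a) \<le> x"
  using assms by (simp add: log_le_iff ge_one_powr_ge_zero)

lemma exp_log_o1_iff:
  "exp_log_o1 f \<longleftrightarrow> (\<forall>\<delta>>0. \<forall>\<^sub>F N in sequentially. f N \<le> 2 powr (log 2 (real N) powr \<delta>))"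
proof -
  have "\<forall>\<^sub>F N in sequentially. 1 < log 2 (real N)" by real_asymp
  then show ?thesis
    unfolding exp_log_o1_def le_two_powr_iff[OF powr_ge_zero] by (rule ex_vanishing_exponent_iff)
qed

lemma near_linear_iff:
  "near_linear f \<longleftrightarrow> (\<forall>\<delta>>0. \<forall>\<^sub>F N in sequentially. f N \<le> real N powr (1 + \<delta>))"
proof -
  have "(\<forall>\<^sub>F N in sequentially. f N \<le> real N powr (1 + \<epsilon> N)) \<longleftrightarrow>
      (\<forall>\<^sub>F N in sequentially. f N / real N \<le> real N powr \<epsilon> N)" for \<epsilon>
    by (rule eventually_subst, rule eventually_mono[OF eventually_gt_at_top[of 0]])
      (simp add: powr_add field_simps)
  moreover have "\<forall>\<^sub>F N in sequentially. 1 < real N" by real_asymp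
  ultimately show ?thesis
    unfolding near_linear_def
    using ex_vanishing_exponent_iff[of real sequentially "\<lambda>N. f N / real N"] by simp
qed

lemma exp_log_o1_mono: "exp_log_o1 g \<Longrightarrow> (\<And>N. f N \<le> g N) \<Longrightarrow> exp_log_o1 f"
  unfolding exp_log_o1_iff by (blast intro: order_trans eventually_mono)

lemma exp_log_o1_const: "exp_log_o1 (\<lambda>N. a)"
  unfolding exp_log_o1_iff le_two_powr_iff[OF powr_ge_zero] by (intro allI impI) real_asymp

lemma eventually_le_half_exponent:
  assumes "exp_log_o1 f" "0 < \<delta>"
  shows "\<forall>\<^sub>F N in sequentially. f N \<le> 2 powr (log 2 (real N) powr (\<delta> / 2))"
  using assms by (simp add: exp_log_o1_iff)

lemma eventually_square_half_exponent:
  assumes "0 < \<delta>"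
  shows "\<forall>\<^sub>F N in sequentially.
    (2 powr (log 2 (real N) powr (\<delta> / 2)))\<^sup>2 \<le> 2 powr (log 2 (real N) powr \<delta>)"
proof -
  have "\<forall>\<^sub>F N in sequentially. 2 * log 2 (real N) powr (\<delta> / 2) \<le> log 2 (real N) powr \<delta>"
    using assms by real_asymp
  then show ?thesis by eventually_elim (simp add: powr_power mult.commute)
qed

lemma exp_log_o1_mult:
  assumes "exp_log_o1 f" "exp_log_o1 g" "\<And>N. 0 \<le> f N" "\<And>N. 0 \<le> g N"
  shows "exp_log_o1 (\<lambda>N. f N * g N)"
  unfolding exp_log_o1_iff
proof (intro allI impI)
  fix \<delta> :: real assume \<delta>: "0 < \<delta>"
  show "\<forall>\<^sub>F N in sequentially. f N * g N \<le> 2 powr (log 2 (real N) powr \<delta>)"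
    using assms(1,2)[THEN eventually_le_half_exponent, OF \<delta>] eventually_square_half_exponent[OF \<delta>]
  proof eventually_elim
    case (elim N)
    have "f N * g N \<le> (2 powr (log 2 (real N) powr (\<delta> / 2)))\<^sup>2"
      unfolding power2_eq_square using elim(1,2) assms(3,4) by (intro mult_mono) auto
    then show ?case using elim(3) by (rule order_trans)
  qed
qed

lemma exp_log_o1_add:
  assumes "exp_log_o1 f" "exp_log_o1 g"
  shows "exp_log_o1 (\<lambda>N. f N + g N)"
  unfolding exp_log_o1_iff
proof (intro allI impI)
  fix \<delta> :: real assume \<delta>: "0 < \<delta>"
  have "\<forall>\<^sub>F N in sequentially. 1 \<le> log 2 (real N) powr (\<delta> / 2)" using \<delta> by real_asymp
  with assms[THEN eventually_le_half_exponent, OF \<delta>] eventually_square_half_exponent[OF \<delta>]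
  show "\<forall>\<^sub>F N in sequentially. f N + g N \<le> 2 powr (log 2 (real N) powr \<delta>)"
  proof eventually_elim
    case (elim N)
    let ?F = "2 powr (log 2 (real N) powr (\<delta> / 2))"
    have "2 \<le> ?F" using elim(4) by (simp add: le_two_powr_iff)
    then have "2 * ?F \<le> ?F\<^sup>2" unfolding power2_eq_square by (rule mult_right_mono) simp
    then show ?case using elim(1-3) by linarith
  qed
qed

lemma exp_log_o1_power:
  assumes "exp_log_o1 f" "\<And>N. 0 \<le> f N"
  shows "exp_log_o1 (\<lambda>N. f N ^ k)"
proof (induction k)
  case (Suc k)
  then show ?case using assms by (auto intro: exp_log_o1_mult)
qed (simp add: exp_log_o1_const)

lemma exp_log_o1_power_polylog:
  fixes l :: "nat \<Rightarrow> nat" and b :: real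
  assumes exp_l: "exp_log_o1 (\<lambda>N. 2 ^ l N)" and base: "1 \<le> b"
  shows "exp_log_o1 (\<lambda>N. b ^ (l N ^ k))"
  unfolding exp_log_o1_iff
proof (intro allI impI)
  fix \<delta> :: real assume \<delta>: "0 < \<delta>"
  define \<delta>' where "\<delta>' = \<delta> / (2 * (real k + 1))"
  let ?L = "\<lambda>N. log 2 (real N)"
  have k\<delta>': "0 < \<delta>'" "real k * \<delta>' \<le> \<delta> / 2" using \<delta> by (simp_all add: \<delta>'_def field_simps)
  then have "\<forall>\<^sub>F N in sequentially. 2 ^ l N \<le> 2 powr (?L N powr \<delta>')"
    using exp_l unfolding exp_log_o1_iff by blast
  moreover have "\<forall>\<^sub>F N in sequentially. log 2 b * ?L N powr (\<delta> / 2) \<le> ?L N powr \<delta>"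
    "\<forall>\<^sub>F N in sequentially. 1 \<le> ?L N"
    using \<delta> by real_asymp+
  ultimately show "\<forall>\<^sub>F N in sequentially. b ^ (l N ^ k) \<le> 2 powr (?L N powr \<delta>)"
  proof eventually_elim
    case (elim N)
    have "2 powr real (l N) \<le> 2 powr (?L N powr \<delta>')" using elim(1) by (simp add: powr_realpow)
    then have "real (l N) ^ k \<le> (?L N powr \<delta>') ^ k" by (intro power_mono) simp_all
    also have "\<dots> = ?L N powr (real k * \<delta>')" using elim(3) by (simp add: powr_power)
    also have "\<dots> \<le> ?L N powr (\<delta> / 2)" using k\<delta>' elim(3) by (intro powr_mono) simp_all
    finally have "log 2 b * real (l N ^ k) \<le> ?L N powr \<delta>"
      using mult_left_mono[of "real (l N ^ k)" "?L N powr (\<delta> / 2)" "log 2 b"] base elim(2) by simp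
    moreover have "b ^ (l N ^ k) = 2 powr (log 2 b * real (l N ^ k))"
      using base by (simp add: powr_powr[symmetric] powr_realpow del: of_nat_power)
    ultimately show ?case by (simp del: of_nat_power)
  qed
qed

lemmas exp_log_o1_intros =
  exp_log_o1_const exp_log_o1_add exp_log_o1_mult exp_log_o1_power

lemma power_floorlog_le: "2 ^ floorlog 2 m \<le> 2 * m + 1"
proof (cases "m = 0")
  case False
  then have "2 ^ (floorlog 2 m - 1) \<le> m" "floorlog 2 m \<noteq> 0"
    using floorlog_bounds[of m 2] by (simp_all add: floorlog_eq_zero_iff)
  then show ?thesis by (cases "floorlog 2 m") simp_all
qed (simp add: floorlog_def)

lemma exp_log_o1_layers:
  assumes base: "1 \<le> B" and length: "exp_log_o1 (\<lambda>N. real (n N))"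
  shows "exp_log_o1 (\<lambda>N. real (layers B (space_bound c k (n N)) (n N)))"
proof -
  let ?l = "\<lambda>N. floorlog 2 (2 * n N)"
  have "exp_log_o1 (\<lambda>N. 2 ^ ?l N)"
  proof (rule exp_log_o1_mono)
    show "exp_log_o1 (\<lambda>N. 4 * real (n N) + 1)" by (intro exp_log_o1_intros length) simp_all
    show "2 ^ ?l N \<le> 4 * real (n N) + 1" for N
      using of_nat_mono[OF power_floorlog_le[of "2 * n N"], where 'a = real] by simp
  qed
  then have "exp_log_o1 (\<lambda>N. real B ^ (?l N ^ k))"
    using base by (intro exp_log_o1_power_polylog) simp_all
  then have "exp_log_o1 (\<lambda>N. real B ^ c * (real B ^ (?l N ^ k)) ^ c)"
    by (intro exp_log_o1_intros) simp_all
  then have "exp_log_o1 (\<lambda>N. real B ^ space_bound c k (n N))"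
    by (simp add: space_bound_def power_add mult_ac flip: power_mult)
  then show ?thesis
    unfolding layers_def sweep_layers_def width_def radix_def of_nat_add of_nat_mult of_nat_power
    by (intro exp_log_o1_intros length) simp_all
qed

lemma len_le_iff: "0 < k \<Longrightarrow> len v \<le> k \<longleftrightarrow> v < 2 ^ k"
  by (simp add: len_def floorlog_le_iff)

lemma len_pos: "0 < len v"
  by (simp add: len_def)

lemma less_two_power_len: "v < 2 ^ len v"
  using len_le_iff[OF len_pos] by blast

lemma len_mult_le: "len (a * b) \<le> len a + len b"
  using mult_strict_mono[OF less_two_power_len[of a] less_two_power_len[of b]]
  by (simp add: len_le_iff len_pos power_add)

lemma len_power_le: "len (a ^ k) \<le> k * len a + 1"
proof -
  have "a ^ k \<le> (2 ^ len a) ^ k"  by (rule power_mono[OF less_imp_le[OF less_two_power_len]]) simp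
  also have "\<dots> < 2 ^ (k * len a + 1)" by (simp add: mult.commute flip: power_mult)
  finally show ?thesis by (simp add: len_le_iff)
qed

lemma len_le_self: "0 < v \<Longrightarrow> len v \<le> v"
  by (simp add: len_le_iff)

lemma len_le_log: "0 < v \<Longrightarrow> real (len v) \<le> 1 + log 2 (real v)"
  by (auto simp: len_def floorlog_def)

lemma len_power_sum_le: "len ((N + m) ^ k) \<le> (k * (m + 2) + 1) * len (N + 1)"
proof -
  have "len (N + m) \<le> len ((N + 1) * (m + 1))" by (intro len_mono) simp
  also have "\<dots> \<le> len (N + 1) + (m + 1)"
    using len_mult_le[of "N + 1" "m + 1"] len_le_self[of "m + 1"] by linarith
  also have "\<dots> \<le> (m + 2) * len (N + 1)"
    using mult_le_mono2[of 1 "len (N + 1)" "m + 1"] len_pos[of "N + 1"] by simp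
  finally have "k * len (N + m) \<le> k * (m + 2) * len (N + 1)"
    unfolding mult.assoc by (rule mult_le_mono2)
  then have "len ((N + m) ^ k) \<le> k * (m + 2) * len (N + 1) + len (N + 1)"
    using len_power_le[of "N + m" k] len_pos[of "N + 1"] by linarith
  then show ?thesis by (simp add: algebra_simps)
qed

lemma near_linear_mult_len:
  assumes "exp_log_o1 f" "\<And>N. 0 \<le> f N"
  shows "near_linear (\<lambda>N. f N * (real (N + 1) * real (len (N + 1))))"
  unfolding near_linear_iff
proof (intro allI impI)
  fix \<delta> :: real assume \<delta>: "0 < \<delta>"
  have "\<forall>\<^sub>F N in sequentially. f N \<le> 2 powr (log 2 (real N) powr (1 / 2))"
    using assms(1) unfolding exp_log_o1_iff by simp
  moreover have "\<forall>\<^sub>F N in sequentially. 2 powr (log 2 (real N) powr (1 / 2)) *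
      (real (N + 1) * (1 + log 2 (real (N + 1)))) \<le> real N powr (1 + \<delta>)"
    using \<delta> by real_asymp
  ultimately show "\<forall>\<^sub>F N in sequentially.
      f N * (real (N + 1) * real (len (N + 1))) \<le> real N powr (1 + \<delta>)"
  proof eventually_elim
    case (elim N)
    have "f N * (real (N + 1) * real (len (N + 1))) \<le>
        2 powr (log 2 (real N) powr (1 / 2)) * (real (N + 1) * (1 + log 2 (real (N + 1))))"
      using elim(1) assms(2) len_le_log[of "N + 1"] by (intro mult_mono) simp_all
    then show ?case using elim(2) by linarith
  qed
qed

section \<open>The reduction\<close>

lemma append_in_pair_language_iff:
  assumes "length a = length b"
  shows "a @ b \<in> pair_language R \<longleftrightarrow> R a b"
proof
  assume "a @ b \<in> pair_language R"
  then obtain a' b' where split: "a @ b = a' @ b'" "length a' = length b'" "R a' b'"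
    unfolding pair_language_def by auto
  from arg_cong[OF split(1), of length] have "length a = length a'" using assms split(2) by simp
  then show "R a b" using split by simp
qed (use assms in \<open>auto simp: pair_language_def\<close>)

lemma log_le_floorlog: "log 2 (real m) \<le> real (floorlog 2 m)"
  by (cases "m = 0") (auto simp: floorlog_def log_def, linarith)

lemma finite_delta_bound:
  assumes "wf_ntm M"
  obtains B where "\<And>q s g q' g' d d'. (q, s, g, q', g', d, d') \<in> ntm_delta M \<Longrightarrow> q' < B \<and> g' < B"
proof -
  let ?f = "\<lambda>(q, s, g, q', g', d, d'). q' + g'"
  have "finite (?f ` ntm_delta M)" using assms by (simp add: wf_ntm_def)
  then obtain B where "\<forall>m\<in>?f ` ntm_delta M. m < B" using finite_nat_set_iff_bounded by auto
  then have "q' + g' < B" if "(q, s, g, q', g', d, d') \<in> ntm_delta M" for q s g q' g' d d'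
    using that by force
  then show thesis using that[of B] by (metis add_lessD1 add.commute)
qed

lemma encodes_sets_pad:
  assumes "string_set N n (set as)" "string_set N n (set bs)" "distinct as" "distinct bs"
  shows "encodes_sets N (n + 1) (pad_left ` set as) (pad_right ` set bs)
    (sets_code N (n + 1) (map pad_left as) (map pad_right bs))"
proof -
  have inj: "inj_on pad_left A" "inj_on pad_right A" for A
    by (auto simp: inj_on_def pad_left_def pad_right_def)
  then have "distinct (map pad_left as)" "distinct (map pad_right bs)"
    using assms by (simp_all add: distinct_map)
  moreover have "string_set N (n + 1) (pad_left ` set as)"
      "string_set N (n + 1) (pad_right ` set bs)"
    using assms inj by (auto simp: string_set_def card_image)
  ultimately show ?thesis unfolding encodes_sets_def by (metis list.set_map)
qed

locale polylog_space_decider =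
  fixes R :: "bool list \<Rightarrow> bool list \<Rightarrow> bool" and M :: ntm and trs :: "transition list"
    and B c k :: nat
  assumes decides: "length a = length b \<Longrightarrow> ntm_accepts M (a @ b) \<longleftrightarrow> R a b"
    and trs: "set trs = ntm_delta M"
    and delta_bound: "(q, s, g, q', g', d, d') \<in> ntm_delta M \<Longrightarrow> q' < B \<and> g' < B"
    and start_bound: "ntm_start M < B"
    and two_le_B: "2 \<le> B"
    and space: "ntm_reachable M x (q, i, h, w) \<Longrightarrow>
      real (h + 1) \<le> real c * log 2 (real (length x)) ^ k + real c"
begin

definition pair_bp :: "nat \<Rightarrow> bp" where
  "pair_bp n = machine_bp M B (space_bound c k n) n"

definition pair_layers :: "nat \<Rightarrow> nat" where
  "pair_layers n = layers B (space_bound c k n) n"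

definition program_size :: nat where
  "program_size = csize (reduction_cmd M B c k trs)"

definition program :: "instr list" where
  "program = compile (reduction_cmd M B c k trs) 0 program_size"

definition time_factor :: "nat \<Rightarrow> nat" where
  "time_factor n = 50 * pair_layers n ^ 3 * (2 * program_size + 4) *
     (5 * (program_size * (pair_layers n + 2 * program_size + 2 + 2) + 1))"

lemma space_le_space_bound:
  assumes "ntm_reachable M x (q, i, h, w)" "length x = 2 * n"
  shows "h < space_bound c k n"
proof -
  have "0 \<le> log 2 (real (2 * n))" by (cases "n = 0") (auto simp: log_def)
  then have "real c * log 2 (real (2 * n)) ^ k + real c \<le> real (space_bound c k n)"
    unfolding space_bound_def of_nat_add of_nat_mult of_nat_power
    using log_le_floorlog[of "2 * n"] by (intro add_right_mono mult_left_mono power_mono) auto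
  then show ?thesis using space[OF assms(1)] assms(2) by simp
qed

lemma pair_bp_accepts_iff:
  assumes "length a = n" "length b = n"
  shows "bp_accepts (pair_bp n) (pad_left a @ pad_right b) \<longleftrightarrow> R a b"
proof -
  interpret bounded_ntm M B "space_bound c k n" n "a @ b"
    using delta_bound start_bound two_le_B space_le_space_bound assms by unfold_locales auto
  show ?thesis
    using machine_bp_accepts_iff decides assms
    by (simp add: pair_bp_def pad_left_def pad_right_def)
qed

lemma satisfying_pair_iff:
  assumes "string_set N n A" "string_set N n A'"
  shows "satisfying_pair R A A' \<longleftrightarrow>
    bp_satisfying_pair (pair_bp n) (pad_left ` A) (pad_right ` A')"
proof -
  have "bp_accepts (pair_bp n) (pad_left a @ pad_right b) \<longleftrightarrow> R a b" if "a \<in> A" "b \<in> A'" for a b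
    using assms that by (intro pair_bp_accepts_iff) (auto simp: string_set_def)
  then show ?thesis unfolding bp_satisfying_pair_def satisfying_pair_def by blast
qed

lemma encodes_pair_bp:
  assumes "encodes_sets N (n + 1) A A' zs"
  shows "encodes_bp_sets N (pair_bp n) A A' (bp_code (pair_bp n) @ zs)"
proof -
  have "wf_bp (pair_bp n)" using wf_machine_bp two_le_B by (simp add: pair_bp_def)
  moreover have "bp_inputs (pair_bp n) = 2 * (n + 1)" by (simp add: pair_bp_def machine_bp_simps)
  ultimately show ?thesis unfolding encodes_bp_sets_def using assms by blast
qed

lemma bp_size_pair_bp_le: "real (bp_size (pair_bp n)) \<le> 2 * real (pair_layers n) ^ 3"
proof -
  let ?W = "width B (space_bound c k n) n"
  have "bp_size (pair_bp n) \<le> 2 * pair_layers n * ?W ^ 2"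
    unfolding pair_bp_def machine_bp_def pair_layers_def layers_def Let_def
    by (rule bp_size_sweep_bp_le)
  also have "\<dots> \<le> 2 * pair_layers n * pair_layers n ^ 2"
    unfolding pair_layers_def by (intro mult_le_mono power_mono le_layers(1) two_le_B) simp_all
  also have "\<dots> = 2 * pair_layers n ^ 3" by (simp add: power2_eq_square power3_eq_cube)
  finally have "real (bp_size (pair_bp n)) \<le> real (2 * pair_layers n ^ 3)"
    by (simp only: of_nat_le_iff)
  then show ?thesis by simp
qed

lemma program_computes:
  assumes "length as = N" "length bs = N" "\<forall>a\<in>set as. length a = n" "\<forall>b\<in>set bs. length b = n"
  shows "\<exists>t. ram_computes program (sets_code N n as bs)
      (bp_code (pair_bp n) @ sets_code N (n + 1) (map pad_left as) (map pad_right bs)) t \<and>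
    real t \<le> real (time_factor n) * (real (N + 1) * real (len (N + 1)))"
proof -
  let ?E = "pair_layers n" and ?Z = program_size
  have "50 * (N + 1) * ?E ^ 3 * (2 * ?Z + 4) * (5 * len ((N + ?E + 2 * ?Z + 2) ^ ?Z)) \<le>
      50 * (N + 1) * ?E ^ 3 * (2 * ?Z + 4) *
        (5 * ((?Z * (?E + 2 * ?Z + 2 + 2) + 1) * len (N + 1)))"
    using len_power_sum_le[of N "?E + 2 * ?Z + 2" ?Z]
    by (intro mult_le_mono2) (simp only: add.assoc)
  also have "\<dots> = time_factor n * ((N + 1) * len (N + 1))"
    unfolding time_factor_def by (simp only: mult_ac)
  finally have "real t \<le> real (time_factor n) * (real (N + 1) * real (len (N + 1)))"
    if "t \<le> 50 * (N + 1) * ?E ^ 3 * (2 * ?Z + 4) * (5 * len ((N + ?E + 2 * ?Z + 2) ^ ?Z))" for t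
    unfolding of_nat_mult[symmetric] of_nat_le_iff using that by (rule order_trans[rotated])
  then show ?thesis
    using reduction_cmd_computes[OF two_le_B trs assms HOL.refl HOL.refl, of c k]
    unfolding program_def program_size_def pair_bp_def pair_layers_def by blast
qed

lemma program_correct:
  assumes "encodes_sets N n A A' xs"
  shows "\<exists>ys t P A1 A1'. ram_computes program xs ys t \<and>
    real t \<le> real (time_factor n) * (real (N + 1) * real (len (N + 1))) \<and>
    encodes_bp_sets N P A1 A1' ys \<and> real (bp_size P) \<le> 2 * real (pair_layers n) ^ 3 \<and>
    (satisfying_pair R A A' \<longleftrightarrow> bp_satisfying_pair P A1 A1')"
proof -
  obtain as bs where lists: "distinct as" "set as = A" "distinct bs" "set bs = A'"
    and xs: "xs = sets_code N n as bs" and sets: "string_set N n A" "string_set N n A'"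
    using assms unfolding encodes_sets_def by blast
  have "length as = N" "length bs = N" "\<forall>a\<in>set as. length a = n" "\<forall>b\<in>set bs. length b = n"
    using lists sets distinct_card[of as] distinct_card[of bs] by (auto simp: string_set_def)
  note program_computes[OF this, folded xs]
  moreover have "encodes_sets N (n + 1) (pad_left ` A) (pad_right ` A')
      (sets_code N (n + 1) (map pad_left as) (map pad_right bs))"
    using encodes_sets_pad lists sets by blast
  ultimately show ?thesis
    using encodes_pair_bp bp_size_pair_bp_le satisfying_pair_iff[OF sets] by blast
qed

lemma exp_log_o1_pair_layers:
  "exp_log_o1 (\<lambda>N. real (n N)) \<Longrightarrow> exp_log_o1 (\<lambda>N. real (pair_layers (n N)))"
  unfolding pair_layers_def using two_le_B by (intro exp_log_o1_layers) simp

lemma exp_log_o1_time_factor: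
  "exp_log_o1 (\<lambda>N. real (n N)) \<Longrightarrow> exp_log_o1 (\<lambda>N. real (time_factor (n N)))"
  unfolding time_factor_def of_nat_add of_nat_mult of_nat_power
  by (intro exp_log_o1_intros exp_log_o1_pair_layers) simp_all

end

lemma polylog_space_deciderE:
  assumes "pair_language R \<in> NSPACE_polylog"
  obtains M trs B c k where "polylog_space_decider R M trs B c k"
proof -
  obtain k c where "pair_language R \<in> NSPACE (\<lambda>n. real c * log 2 (real n) ^ k + real c)"
    using assms unfolding NSPACE_polylog_def by blast
  then obtain M where machine: "wf_ntm M" "\<And>x. x \<in> pair_language R \<longleftrightarrow> ntm_accepts M x"
    "\<And>x q i h w. ntm_reachable M x (q, i, h, w) \<Longrightarrow>
      real (h + 1) \<le> real c * log 2 (real (length x)) ^ k + real c"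
    unfolding NSPACE_def by blast
  obtain B where delta_bound: "\<And>q s g q' g' d d'.
    (q, s, g, q', g', d, d') \<in> ntm_delta M \<Longrightarrow> q' < B \<and> g' < B"
    using finite_delta_bound[OF machine(1)] by blast
  obtain trs where trs: "set trs = ntm_delta M"
    using finite_list machine(1) unfolding wf_ntm_def by blast
  have "polylog_space_decider R M trs (B + ntm_start M + 2) c k"
  proof
    show "ntm_accepts M (a @ b) \<longleftrightarrow> R a b" if "length a = length b" for a b
      using machine(2) append_in_pair_language_iff[OF that] by blast
    show "q' < B + ntm_start M + 2 \<and> g' < B + ntm_start M + 2"
      if "(q, s, g, q', g', d, d') \<in> ntm_delta M" for q s g q' g' d d'
      using delta_bound[OF that] by simp
    show "real (h + 1) \<le> real c * log 2 (real (length x)) ^ k + real c"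
      if "ntm_reachable M x (q, i, h, w)" for x q i h w
      using machine(3)[OF that] .
  qed (simp_all add: trs)
  then show thesis by (rule that)
qed

theorem theorem4p1:
  fixes \<A> :: "bool list \<Rightarrow> bool list \<Rightarrow> bool"
    and len_of :: "nat \<Rightarrow> nat"
  assumes "pair_language \<A> \<in> NSPACE_polylog"
    and "exp_log_o1 (\<lambda>N. real (len_of N))"
  shows "\<exists>(p :: instr list) (time :: nat \<Rightarrow> real) (size :: nat \<Rightarrow> real).
           near_linear time \<and> exp_log_o1 size \<and>
           (\<forall>N A B xs. encodes_sets N (len_of N) A B xs \<longrightarrow>
              (\<exists>ys t P A' B'.
                 ram_computes p xs ys t \<and> real t \<le> time N \<and>
                 encodes_bp_sets N P A' B' ys \<and> real (bp_size P) \<le> size N \<and>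
                 (satisfying_pair \<A> A B \<longleftrightarrow> bp_satisfying_pair P A' B')))"
proof -
  obtain M trs B c k where "polylog_space_decider \<A> M trs B c k"
    using polylog_space_deciderE[OF assms(1)] .
  then interpret polylog_space_decider \<A> M trs B c k .
  let ?time = "\<lambda>N. real (time_factor (len_of N)) * (real (N + 1) * real (len (N + 1)))"
  let ?size = "\<lambda>N. 2 * real (pair_layers (len_of N)) ^ 3"
  have "near_linear ?time"
    by (rule near_linear_mult_len[OF exp_log_o1_time_factor[OF assms(2)]]) simp
  moreover have "exp_log_o1 ?size"
    by (intro exp_log_o1_intros exp_log_o1_pair_layers assms(2)) simp_all
  moreover note program_correct
  ultimately show ?thesis by blast
qed

end
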